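(* Let $X$ and $Y$ be non-negative independent random variables with probability density functions, for $x>0$ and $y>0$, $$f(x)=x^{\alpha-1}\sum_{m=1}^{M}a_{m}e^{-\xi_{m}x},\qquad g(y)=y^{\beta-1}\sum_{n=1}^{N}b_{n}e^{-\eta_{n}y},$$ where $\alpha,\beta>0$, $a_m,b_n\in\mathbb{C}$, and $\xi_m,\eta_n\in\mathbb{C}$ satisfy $\operatorname{Re}(\xi_m)>0$ and $\operatorname{Re}(\eta_n)>0$ for all $1\le m\le M$, $1\le n\le N$. Then the probability density function $p(t)=\int_0^\infty f(x)\,g(t/x)\,\frac{1}{x}\,dx$ of the product $XY$ can be written, for $t>0$, as $$p(t)=t^{(\alpha+\beta-2-|\alpha-\beta|)/2}\,v(t),$$ where $$v(t)=2\sum_{m=1}^{M}\sum_{n=1}^{N}a_{m}b_{n}\left(\frac{\eta_{n}}{\xi_{m}}\right)^{(\alpha-\beta)/2}t^{|\alpha-\beta|/2}K_{|\alpha-\beta|}\bigl(2\sqrt{t\,\xi_{m}\eta_{n}}\bigr).$$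
   Context: $K_\nu$ denotes the modified Bessel function of the second kind of order $\nu$. Complex powers, square roots and $K_\nu$ are taken with their principal branches. The coefficients $a_m,b_n$ and exponents $\xi_m,\eta_n$ may be complex, but $f$ and $g$ are probability density functions supported on the non-negative half-line. *)

theory Defs
  imports "HOL-Probability.Probability"
begin

text \<open>
  Modified Bessel functions of complex order and argument, on the principal branch. They are meant
  for nonzero arguments only: \<open>0 powr \<nu> = 0\<close> makes the value at \<open>z = 0\<close> a dummy. The reciprocal
  Gamma function is entire, so terms at a pole of Gamma vanish, as they should.
\<close>

definition bessel_I :: "complex \<Rightarrow> complex \<Rightarrow> complex" where
  "bessel_I \<nu> z =
     (z / 2) powr \<nu> * (\<Sum>k. (z / 2) ^ (2 * k) * rGamma (\<nu> + of_nat k + 1) / fact k)"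

definition bessel_K_quotient :: "complex \<Rightarrow> complex \<Rightarrow> complex" where
  "bessel_K_quotient \<nu> z =
     of_real pi / 2 * (bessel_I (- \<nu>) z - bessel_I \<nu> z) / sin (of_real pi * \<nu>)"

text \<open>
  At integer orders the quotient has the form 0/0; its singularity there (in \<open>\<nu>\<close>) is removable and
  the function of the second kind is the limiting value.
\<close>

definition bessel_K :: "complex \<Rightarrow> complex \<Rightarrow> complex" where
  "bessel_K \<nu> z =
     (if \<nu> \<in> \<int> then Lim (at \<nu>) (\<lambda>\<mu>. bessel_K_quotient \<mu> z) else bessel_K_quotient \<nu> z)"

definition product_density :: "(real \<Rightarrow> real) \<Rightarrow> (real \<Rightarrow> real) \<Rightarrow> real \<Rightarrow> real" where
  "product_density f g t = (LINT x:{0<..}|lborel. f x * g (t / x) * (1 / x))"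

end

theory Submission
  imports Defs "HOL-Complex_Analysis.Complex_Analysis" "HOL-Real_Asymp.Real_Asymp"
begin

text \<open>
  Substituting \<open>x = e\<^bsup>s\<^esup>\<close>, the density of the product is a combination of the integrals
  \<open>G\<^sub>\<nu>(\<xi>, c) = \<integral> exp (\<nu> s - \<xi> e\<^bsup>s\<^esup> - c e\<^bsup>-s\<^esup>) ds\<close>, and the point is to identify these
  with the Bessel functions of the second kind, which are defined through power series.
  For \<open>0 < Re \<nu> < 1\<close>, the function \<open>c \<mapsto> G\<^sub>\<nu>(\<xi>, c)\<close> and the two series solve the same linear
  second order equation. Their Wronskians are constant and can be read off at \<open>c \<rightarrow> 0\<close>, where
  \<open>G\<close> degenerates to Gamma integrals; this expresses \<open>G\<close> through the series. All
  terms are entire in \<open>\<nu>\<close>, so the relation extends to every complex order, and the integer orders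
  follow because \<open>G\<close> is continuous in \<open>\<nu>\<close>.
\<close>

subsection \<open>The power series of the Bessel functions\<close>

text \<open>The integral keeps two parameters although the Bessel function sees only the product
  \<open>\<xi> * c\<close>. With \<xi> frozen, c is a plain variable in the right half-plane, where
  its principal powers are holomorphic; the square root of \<open>\<xi> * c\<close> enters only at
  the end, where both arguments lie below pi / 2 in size and the principal logarithm is additive.
  The strip is where both components of the first order system have finite limits at 0: the integral
  tends to a multiple of Gamma \<nu>, its weighted derivative to Gamma (1 - \<nu>), and one Euler
  integral asks for Re \<nu> > 0, the other for Re \<nu> < 1. Three vectors in the plane satisfy a
  linear relation whose coefficients are their pairwise determinants, and these are the three
  Wronskians. The relation stays multiplied by sin (pi \<nu>), so both sides are entire in the
  order. Exchanging \<xi> and c reverses the sign of the order; this symmetry is the source of the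
  absolute value of \<alpha> - \<beta>.\<close>

definition bessel_series :: "complex \<Rightarrow> complex \<Rightarrow> complex" where
  "bessel_series \<nu> w = (\<Sum>k. rGamma (\<nu> + of_nat k + 1) / fact k * w ^ k)"

text \<open>Since \<open>rGamma z = z * rGamma (z + 1)\<close>, a shift by one cannot increase the
  norm once the argument has norm at least 1; the finitely many earlier shifts stay in a compact
  disc. Uniformity over a disc is what holomorphy in the order requires.\<close>

lemma bounded_rGamma_shifts:
  obtains B where "\<And>z k. norm z \<le> R \<Longrightarrow> norm (rGamma (z + of_nat k :: complex)) \<le> B"
proof -
  define K where "K = nat \<lceil>R\<rceil> + 1"
  have K: "real K \<ge> R + 1" unfolding K_def by linarith
  have "compact (rGamma ` cball (0::complex) (R + K))"
    by (intro compact_continuous_image continuous_intros) auto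
  then obtain B where B: "\<And>z. norm z \<le> R + K \<Longrightarrow> norm (rGamma (z::complex)) \<le> B"
    by (meson bounded_iff compact_imp_bounded image_eqI mem_cball_0)
  have *: "norm (rGamma (z + of_nat (K + n))) \<le> B" if z: "norm z \<le> R" for z :: complex and n
  proof (induction n)
    case 0
    have "norm (z + of_nat K) \<le> R + K"
      using norm_triangle_ineq[of z "of_nat K"] z by simp
    then show ?case using B by simp
  next
    case (Suc n)
    let ?w = "z + of_nat (K + n)"
    have "real K + real n - norm z \<le> norm ?w"
      using norm_triangle_ineq2[of "of_nat (K + n)" "-z"] norm_of_nat[of "K + n", where 'a=complex]
      by (simp add: add.commute)
    then have "1 \<le> norm ?w" using z K by linarith
    then have "norm (rGamma (?w + 1)) \<le> norm ?w * norm (rGamma (?w + 1))"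
      by (simp add: mult_left_le_imp_le mult_le_cancel_right1)
    also have "\<dots> = norm (rGamma ?w)"
      by (metis norm_mult rGamma_plus1)
    finally show ?case using Suc by (simp add: add_ac)
  qed
  show ?thesis
  proof
    fix z :: complex and k assume z: "norm z \<le> R"
    show "norm (rGamma (z + of_nat k)) \<le> B"
    proof (cases "k \<ge> K")
      case True
      then show ?thesis using *[OF z, of "k - K"] by simp
    next
      case False
      then have "norm (z + of_nat k) \<le> R + K"
        using norm_triangle_ineq[of z "of_nat k"] z by simp
      then show ?thesis using B by simp
    qed
  qed
qed

lemma summable_bessel_series:
  fixes \<nu> w :: complex
  shows "summable (\<lambda>k. rGamma (\<nu> + of_nat k + 1) / fact k * w ^ k)"
proof -
  obtain B where B: "\<And>k. norm (rGamma (\<nu> + 1 + of_nat k :: complex)) \<le> B"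
    using bounded_rGamma_shifts[of "norm (\<nu> + 1)"] by (metis order_refl)
  have "summable (\<lambda>k. B * (norm w ^ k /\<^sub>R fact k))"
    by (intro summable_mult summable_exp_generic)
  then show ?thesis
    by (rule summable_comparison_test'[of _ 0])
      (use mult_right_mono[OF B, of "norm w ^ _ / fact _"]
        in \<open>simp add: norm_mult norm_divide norm_power norm_inverse add_ac divide_inverse mult_ac\<close>)
qed

text \<open>Weierstrass test on a unit disc of orders: a common bound \<open>B\<close> for the
  reciprocal Gamma factors leaves an exponential series as majorant.\<close>

lemma bessel_series_holomorphic_order [holomorphic_intros]:
  assumes "f holomorphic_on A"
  shows "(\<lambda>\<nu>. bessel_series (f \<nu>) w) holomorphic_on A"
proof -
  have "\<exists>d h. 0 < d \<and> summable h \<and> range h \<subseteq> \<real>\<^sub>\<ge>\<^sub>0 \<and>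
      (\<forall>\<^sub>F k in sequentially. \<forall>\<nu>\<in>ball x d \<inter> UNIV.
         cmod (rGamma (\<nu> + of_nat k + 1) / fact k * w ^ k) \<le> cmod (h k))" for x
  proof -
    \<comment> \<open>The 2 allows 1 for the distance of \<nu> from \<open>x\<close> and 1 for the
      shift to \<open>\<nu> + 1\<close>.\<close>
    obtain B where B: "\<And>\<nu> k. norm \<nu> \<le> norm x + 2 \<Longrightarrow> norm (rGamma (\<nu> + of_nat k :: complex)) \<le> B"
      using bounded_rGamma_shifts by blast
    have B': "norm (rGamma (\<nu> + of_nat k + 1)) \<le> B" if "\<nu> \<in> ball x 1" for \<nu> k
    proof -
      have "norm (\<nu> + 1) \<le> norm x + 2"
        using that norm_triangle_ineq[of \<nu> 1] norm_triangle_ineq2[of \<nu> x]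
        by (simp add: dist_norm norm_minus_commute)
      from B[OF this] show ?thesis by (simp add: add_ac)
    qed
    have B0: "B \<ge> 0" using B'[of x 0] norm_ge_zero by (meson centre_in_ball order_trans zero_less_one)
    define h where "h = (\<lambda>k. B * (norm w ^ k /\<^sub>R fact k))"
    have "summable h"
      unfolding h_def by (intro summable_mult summable_exp_generic)
    then have "summable (\<lambda>k. complex_of_real (h k))"
      by (simp only: summable_of_real)
    moreover have h0: "h k \<ge> 0" for k using B0 by (simp add: h_def)
    moreover have "cmod (rGamma (\<nu> + of_nat k + 1) / fact k * w ^ k) \<le> h k" if "\<nu> \<in> ball x 1" for \<nu> k
      using mult_right_mono[OF B'[OF that, of k], of "norm w ^ k / fact k"]
      by (simp add: h_def norm_mult norm_divide norm_power field_simps)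
    ultimately show ?thesis
      by (intro exI[of _ 1] exI[of _ "\<lambda>k. complex_of_real (h k)"] conjI always_eventually)
        (auto simp: h0)
  qed
  note bound = this
  have "(\<lambda>\<nu>. rGamma (\<nu> + of_nat k + 1) / fact k * w ^ k) field_differentiable (at x)" for k x
    by (rule holomorphic_on_imp_differentiable_at[of _ UNIV]) (auto intro!: holomorphic_intros)
  from series_differentiable_comparison_complex[OF open_UNIV this bound]
  obtain g where g: "\<forall>x\<in>UNIV. ((\<lambda>k. rGamma (x + of_nat k + 1) / fact k * w ^ k) sums g x)
      \<and> g field_differentiable (at x)"
    by blast
  then have "g = (\<lambda>\<nu>. bessel_series \<nu> w)"
    by (auto simp: bessel_series_def sums_iff)
  with g have "(\<lambda>\<nu>. bessel_series \<nu> w) holomorphic_on UNIV"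
    by (auto simp: holomorphic_on_def)
  then have "(\<lambda>\<nu>. bessel_series \<nu> w) \<circ> f holomorphic_on A"
    by (rule holomorphic_on_compose_gen[OF assms]) auto
  then show ?thesis by (simp add: o_def)
qed

text \<open>This is the Bessel-Clifford function: with the branch factor kept outside the series,
  differentiation cancels one factor of the factorial and raises the order, leaving no power of
  \<open>w\<close> in front.\<close>

lemma bessel_series_has_field_derivative:
  "(bessel_series \<nu> has_field_derivative bessel_series (\<nu> + 1) w) (at w)"
proof -
  have "((\<lambda>x. suminf (\<lambda>n. (rGamma (\<nu> + of_nat n + 1) / fact n) * x ^ n)) has_field_derivative
      (\<Sum>n. diffs (\<lambda>n. rGamma (\<nu> + of_nat n + 1) / fact n) n * w ^ n)) (at w)"
    by (rule termdiffs_strong_converges_everywhere) (rule summable_bessel_series)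
  moreover have "diffs (\<lambda>n. rGamma (\<nu> + of_nat n + 1) / fact n) n = rGamma (\<nu> + 1 + of_nat n + 1) / fact n" for n
    by (simp add: diffs_def add_ac field_simps del: of_nat_Suc) (simp add: add_ac)
  ultimately show ?thesis unfolding bessel_series_def [abs_def] by simp
qed

text \<open>The first summand multiplies the k-th term of order \<nu> by k, so the left side
  multiplies it by \<open>\<nu> + k\<close>, and the functional equation of \<open>rGamma\<close>
  absorbs this factor by lowering the order.\<close>

lemma bessel_series_recurrence:
  "w * bessel_series (\<nu> + 1) w + \<nu> * bessel_series \<nu> w = bessel_series (\<nu> - 1) w"
proof -
  let ?a = "\<lambda>\<nu> k. rGamma (\<nu> + of_nat k + 1) / fact k * w ^ k"
  have s: "?a \<nu> sums bessel_series \<nu> w" for \<nu>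
    using summable_bessel_series[of \<nu> w] by (simp add: bessel_series_def summable_sums)
  have "(\<lambda>k. w * ?a (\<nu> + 1) k) sums (w * bessel_series (\<nu> + 1) w)"
    by (intro sums_mult s)
  moreover have "w * ?a (\<nu> + 1) k = of_nat (Suc k) * ?a \<nu> (Suc k)" for k
    by (simp add: add_ac field_simps del: of_nat_Suc) (simp add: add_ac)
  ultimately have "(\<lambda>k. of_nat (Suc k) * ?a \<nu> (Suc k)) sums (w * bessel_series (\<nu> + 1) w)"
    by simp
  then have "(\<lambda>k. of_nat k * ?a \<nu> k) sums (w * bessel_series (\<nu> + 1) w)"
    by (subst (asm) sums_Suc_iff) simp
  then have "(\<lambda>k. of_nat k * ?a \<nu> k + \<nu> * ?a \<nu> k) sums (w * bessel_series (\<nu> + 1) w + \<nu> * bessel_series \<nu> w)"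
    by (intro sums_add sums_mult s)
  moreover have "of_nat k * ?a \<nu> k + \<nu> * ?a \<nu> k = ?a (\<nu> - 1) k" for k
  proof -
    have "of_nat k * ?a \<nu> k + \<nu> * ?a \<nu> k = ((\<nu> + of_nat k) * rGamma (\<nu> + of_nat k + 1)) / fact k * w ^ k"
      by (simp add: algebra_simps add_divide_distrib)
    then show ?thesis by (simp only: rGamma_plus1) simp
  qed
  ultimately show ?thesis using s[of "\<nu> - 1"] sums_unique2 by simp
qed

lemma bessel_series_0 [simp]: "bessel_series \<nu> 0 = rGamma (\<nu> + 1)"
  unfolding bessel_series_def by (subst powser_zero) simp

lemma bessel_I_eq: "bessel_I \<nu> z = (z / 2) powr \<nu> * bessel_series \<nu> ((z / 2)\<^sup>2)"
proof -
  have "(z / 2) ^ (2 * k) * rGamma (\<nu> + of_nat k + 1) / fact k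
      = rGamma (\<nu> + of_nat k + 1) / fact k * ((z / 2)\<^sup>2) ^ k" for k
    unfolding power_mult by simp
  then show ?thesis
    unfolding bessel_I_def bessel_series_def by (simp only:)
qed

subsection \<open>Parameter integrals and the substitution \<open>x = e\<^bsup>s\<^esup>\<close>\<close>

text \<open>Only the integrand needs an integrable majorant: Cauchy's inequality turns it into one
  for the derivative on a smaller disc, and that dominates all difference quotients.\<close>

lemma has_field_derivative_integral:
  fixes f :: "complex \<Rightarrow> 'a \<Rightarrow> complex"
  assumes r: "r > 0"
    and meas: "\<And>z. z \<in> ball z0 r \<Longrightarrow> f z \<in> borel_measurable M"
    and deriv: "\<And>z x. z \<in> ball z0 r \<Longrightarrow> ((\<lambda>z. f z x) has_field_derivative f' z x) (at z)"
    and bound: "\<And>z x. z \<in> ball z0 r \<Longrightarrow> norm (f z x) \<le> w x"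
    and w: "integrable M w"
  shows "((\<lambda>z. \<integral>x. f z x \<partial>M) has_field_derivative (\<integral>x. f' z0 x \<partial>M)) (at z0)"
proof -
  have int: "integrable M (f z)" if "z \<in> ball z0 r" for z
    by (rule Bochner_Integration.integrable_bound[OF w meas[OF that]])
      (use bound[OF that] in \<open>auto intro!: AE_I2 intro: order_trans[OF _ abs_ge_self]\<close>)
  \<comment> \<open>Discs of radius \<open>r / 3\<close> around points of
    \<open>ball z0 (r / 2)\<close> stay inside \<open>ball z0 r\<close>, since 1/2 + 1/3 < 1; this
    is the room for Cauchy's inequality.\<close>
  have f'_bound: "norm (f' z x) \<le> w x / (r / 3)" if z: "z \<in> ball z0 (r / 2)" for z x
  proof -
    have sub: "u \<in> ball z0 r" if "dist z u \<le> r / 3" for u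
      using that z r dist_triangle[of z0 u z] by simp
    have hol: "(\<lambda>z. f z x) holomorphic_on ball z0 r"
      using deriv by (meson holomorphic_on_open open_ball)
    have "norm ((deriv ^^ 1) (\<lambda>z. f z x) z) \<le> fact 1 * w x / (r / 3) ^ 1"
    proof (rule Cauchy_inequality)
      show "(\<lambda>z. f z x) holomorphic_on ball z (r / 3)"
        by (rule holomorphic_on_subset[OF hol]) (use sub in auto)
      show "continuous_on (cball z (r / 3)) (\<lambda>z. f z x)"
        by (rule continuous_on_subset[OF holomorphic_on_imp_continuous_on[OF hol]]) (use sub in auto)
      show "norm (f u x) \<le> w x" if "norm (z - u) = r / 3" for u
        by (rule bound, rule sub) (use that in \<open>simp add: dist_norm\<close>)
    qed (use r in simp)
    moreover have "deriv (\<lambda>z. f z x) z = f' z x"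
      using z r by (intro DERIV_imp_deriv deriv) auto
    ultimately show ?thesis by simp
  qed
  have "(\<lambda>n. ((\<integral>x. f (X n) x \<partial>M) - (\<integral>x. f z0 x \<partial>M)) / (X n - z0)) \<longlonglongrightarrow> (\<integral>x. f' z0 x \<partial>M)"
    if X: "\<And>n. X n \<noteq> z0" and X_lim: "X \<longlonglongrightarrow> z0" and X_near: "\<And>n. X n \<in> ball z0 (r / 2)" for X
  proof -
    let ?q = "\<lambda>n x. (f (X n) x - f z0 x) / (X n - z0)"
    have X_in: "X n \<in> ball z0 r" for n using X_near[of n] r by simp
    have z0_in: "z0 \<in> ball z0 r" using r by simp
    have lim: "(\<lambda>n. ?q n x) \<longlonglongrightarrow> f' z0 x" for x
    proof -
      have "((\<lambda>z. (f z x - f z0 x) / (z - z0)) \<longlongrightarrow> f' z0 x) (at z0)"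
        using deriv[OF z0_in] by (simp add: has_field_derivative_iff)
      then show ?thesis
        using X X_lim unfolding tendsto_at_iff_sequentially by (auto simp: o_def)
    qed
    have meas_q: "?q n \<in> borel_measurable M" for n
      using meas[OF X_in[of n]] meas[OF z0_in] by measurable
    have "(\<lambda>n. \<integral>x. ?q n x \<partial>M) \<longlonglongrightarrow> (\<integral>x. f' z0 x \<partial>M)"
    proof (rule integral_dominated_convergence[where w = "\<lambda>x. w x / (r / 3)"])
      show "f' z0 \<in> borel_measurable M"
        by (rule borel_measurable_LIMSEQ_metric[OF meas_q lim])
      show "AE x in M. norm (?q n x) \<le> w x / (r / 3)" for n
      proof (rule AE_I2)
        fix x
        have "norm (f (X n) x - f z0 x) \<le> w x / (r / 3) * norm (X n - z0)"
          by (rule field_differentiable_bound[of "ball z0 (r / 2)" "\<lambda>z. f z x" "\<lambda>z. f' z x"])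
            (use X_near r f'_bound in \<open>auto intro!: has_field_derivative_at_within[OF deriv]\<close>)
        then show "norm (?q n x) \<le> w x / (r / 3)"
          using X[of n] by (simp add: norm_divide divide_le_eq)
      qed
    qed (use meas_q lim w in \<open>auto\<close>)
    then show ?thesis
      using int[OF X_in] int[OF z0_in] by (simp add: Bochner_Integration.integral_diff)
  qed
  then have "((\<lambda>z. ((\<integral>x. f z x \<partial>M) - (\<integral>x. f z0 x \<partial>M)) / (z - z0)) \<longlongrightarrow> (\<integral>x. f' z0 x \<partial>M))
      (at z0 within ball z0 (r / 2))"
    unfolding tendsto_at_iff_sequentially by (auto simp: o_def)
  then show ?thesis
    using r at_within_open[of z0 "ball z0 (r / 2)"] by (simp add: has_field_derivative_iff)
qed

lemma exp_substitution:
  fixes F :: "real \<Rightarrow> complex"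
  assumes cont: "continuous_on {0<..} F"
    and int: "integrable lborel (\<lambda>s. of_real (exp s) * F (exp s))"
  shows "set_integrable lborel {0<..} F"
    and "(LINT x:{0<..}|lborel. F x) = (\<integral>s. of_real (exp s) * F (exp s) \<partial>lborel)"
proof -
  have isCont: "isCont F (exp s)" for s
    using cont by (simp add: continuous_on_eq_continuous_at)
  have e: "einterval (-\<infinity>) \<infinity> = UNIV" "einterval 0 \<infinity> = {0<..}"
    by (auto simp: einterval_def)
  have lim0: "((ereal \<circ> exp \<circ> real_of_ereal) \<longlongrightarrow> 0) (at_right (-\<infinity>))"
    using exp_at_bot by (simp add: ereal_tendsto_simps zero_ereal_def)
  have lim_top: "((ereal \<circ> exp \<circ> real_of_ereal) \<longlongrightarrow> \<infinity>) (at_left \<infinity>)"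
    using exp_at_top by (simp add: ereal_tendsto_simps)
  \<comment> \<open>The substitution rule for complex integrands presupposes integrability on both
    sides, so the nonnegative rule is applied to the norm of \<open>F\<close> before it.\<close>
  have norm_int: "set_integrable lborel (einterval (-\<infinity>) \<infinity>) (\<lambda>s. norm (F (exp s)) * exp s)"
    using integrable_norm[OF int] by (simp add: set_integrable_def e norm_mult mult.commute)
  have "set_integrable lborel (einterval 0 \<infinity>) (\<lambda>x. norm (F x))"
    by (rule interval_integral_substitution_nonneg(1)[where g = exp and g' = exp, OF _ _ _ _ _ _ lim0 lim_top norm_int])
      (auto intro!: derivative_eq_intros continuous_intros isCont)
  then have *: "integrable lborel (\<lambda>x. indicator {0<..} x * norm (F x))"
    by (simp add: set_integrable_def e)
  have "(\<lambda>x. indicator {0<..} x *\<^sub>R F x) \<in> borel_measurable lborel"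
    using borel_measurable_continuous_on_indicator[OF _ cont] by simp
  then show *: "set_integrable lborel {0<..} F"
    unfolding set_integrable_def
    by (rule Bochner_Integration.integrable_bound[OF *]) (auto simp: indicator_def)
  have "(LBINT x=0..\<infinity>. F x) = (LBINT s=-\<infinity>..\<infinity>. exp s *\<^sub>R F (exp s))"
    by (rule interval_integral_substitution_integrable[OF _ _ _ _ _ lim0 lim_top])
      (use int * in \<open>auto intro!: derivative_eq_intros continuous_intros isCont
         simp: e set_integrable_def scaleR_conv_of_real\<close>)
  then show "(LINT x:{0<..}|lborel. F x) = (\<integral>s. of_real (exp s) * F (exp s) \<partial>lborel)"
    by (simp add: interval_lebesgue_integral_def e set_lebesgue_integral_def scaleR_conv_of_real)
qed

subsection \<open>The integral representation\<close>

definition bessel_kernel :: "complex \<Rightarrow> complex \<Rightarrow> complex \<Rightarrow> real \<Rightarrow> complex" where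
  "bessel_kernel \<nu> \<xi> c s = exp (\<nu> * of_real s - \<xi> * of_real (exp s) - c * of_real (exp (- s)))"

text \<open>For \<open>\<xi> = c = z / 2\<close> with Re z > 0 the integrand is exp (\<nu> s - z
  cosh s), the classical integral for twice the Bessel function of the second kind at z. Separate
  parameters make room for the boundary case \<open>c = 0\<close>, which is a Gamma
  integral.\<close>

definition bessel_integral :: "complex \<Rightarrow> complex \<Rightarrow> complex \<Rightarrow> complex" where
  "bessel_integral \<nu> \<xi> c = (\<integral>s. bessel_kernel \<nu> \<xi> c s \<partial>lborel)"

section \<open>Size of the kernel and integrable majorants\<close>

lemma norm_bessel_kernel:
  "norm (bessel_kernel \<nu> \<xi> c s) = exp (Re \<nu> * s - Re \<xi> * exp s - Re c * exp (- s))"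
  by (simp add: bessel_kernel_def)

lemma continuous_bessel_kernel: "continuous_on A (bessel_kernel \<nu> \<xi> c)"
  unfolding bessel_kernel_def [abs_def] by (intro continuous_intros)

lemma bessel_kernel_measurable [measurable]: "bessel_kernel \<nu> \<xi> c \<in> borel_measurable borel"
  by (rule borel_measurable_continuous_onI[OF continuous_bessel_kernel])

lemma bessel_kernel_shift:
  "bessel_kernel (\<nu> + 1) \<xi> c s = of_real (exp s) * bessel_kernel \<nu> \<xi> c s"
  "bessel_kernel (\<nu> - 1) \<xi> c s = of_real (exp (- s)) * bessel_kernel \<nu> \<xi> c s"
  by (simp_all add: bessel_kernel_def ring_distribs exp_add exp_diff exp_minus exp_of_real divide_inverse)

text \<open>The right side is the tangent of slope \<open>p\<close> to \<open>a * exp s\<close>,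
  touching at \<open>ln (p / a)\<close>. As \<open>p\<close> is free, a double exponential beats an
  exponential of any prescribed rate.\<close>

lemma exp_ge_tangent:
  fixes s :: real
  assumes "a > 0" "p > 0"
  shows "a * exp s \<ge> p * (1 + s - ln (p / a))"
proof -
  have "p * exp (s - ln (p / a)) = a * exp s"
    using assms by (simp add: exp_diff)
  moreover have "1 + (s - ln (p / a)) \<le> exp (s - ln (p / a))"
    by (rule exp_ge_add_one_self)
  ultimately show ?thesis
    using assms by (metis add_diff_eq less_imp_le mult_left_mono)
qed

lemma integrable_gamma_kernel:
  fixes \<sigma> a :: real
  assumes "\<sigma> > 0" "a > 0"
  shows "integrable lborel (\<lambda>s. exp (\<sigma> * s - a * exp s))"
proof -
  \<comment> \<open>The constant of the tangent of slope \<open>\<sigma> + 1\<close>: the slope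
    exceeds \<sigma> by 1 and so leaves a factor \<open>exp (- s)\<close>.\<close>
  define C where "C = exp ((\<sigma> + 1) * ln ((\<sigma> + 1) / a) - (\<sigma> + 1))"
  have exp_int: "integrable lborel (\<lambda>s. indicator {0<..} s * exp (- (s * u)))" if "u > 0" for u :: real
    using integrable_I0i_exp_mscale[OF that] by (simp add: set_integrable_def)
  \<comment> \<open>The majorant is \<open>exp (\<sigma> * s)\<close> left of 0 and
    \<open>C * exp (- s)\<close> right of it, the left half being written as an affine image of an
    integral over the positive axis. At \<open>s = 0\<close> both indicators vanish, hence the
    exceptional null set below.\<close>
  let ?w = "\<lambda>s. indicator {0<..} (0 + - 1 * s) * exp (- ((0 + - 1 * s) * \<sigma>))
      + C * (indicator {0<..} s * exp (- (s * 1)))"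
  have w: "integrable lborel ?w"
    by (intro Bochner_Integration.integrable_add integrable_mult_right exp_int
        lborel_integrable_real_affine[where f = "\<lambda>s. indicator {0<..} s * exp (- (s * \<sigma>))"]) (use assms in auto)
  show ?thesis
  proof (rule Bochner_Integration.integrable_bound[OF w])
    show "AE s in lborel. norm (exp (\<sigma> * s - a * exp s)) \<le> norm (?w s)"
      using AE_lborel_singleton[of 0]
    proof eventually_elim
      fix s :: real assume "s \<noteq> 0"
      then consider "s < 0" | "s > 0" by linarith
      then show "norm (exp (\<sigma> * s - a * exp s)) \<le> norm (?w s)"
      proof cases
        case 1
        then show ?thesis using assms by (simp add: mult.commute)
      next
        case 2
        have "\<sigma> * s - a * exp s \<le> ((\<sigma> + 1) * ln ((\<sigma> + 1) / a) - (\<sigma> + 1)) - s"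
          using exp_ge_tangent[of a "\<sigma> + 1" s] assms by (simp add: algebra_simps)
        then have "exp (\<sigma> * s - a * exp s) \<le> C * exp (- s)"
          unfolding C_def exp_add[symmetric] by simp
        then show ?thesis using 2 by (simp add: C_def)
      qed
    qed
  qed measurable
qed

lemma integrable_bessel_kernel_real:
  fixes \<sigma> a b :: real
  assumes "a > 0" "b > 0 \<or> b = 0 \<and> \<sigma> > 0"
  shows "integrable lborel (\<lambda>s. exp (\<sigma> * s - a * exp s - b * exp (- s)))"
proof (cases "b = 0")
  case True
  then show ?thesis using integrable_gamma_kernel[of \<sigma> a] assms by auto
next
  case False
  with assms have b: "b > 0" by auto
  \<comment> \<open>The tangent of slope \<open>q\<close>, taken at \<open>- s\<close>, trades
    \<open>exp (- b * exp (- s))\<close> for a constant times \<open>exp (q * s)\<close>. This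
    choice makes \<open>\<sigma> + q\<close> positive and reduces the claim to the Gamma
    kernel.\<close>
  define q where "q = \<bar>\<sigma>\<bar> + 1"
  have q: "q > 0" "\<sigma> + q > 0" by (auto simp: q_def)
  have "integrable lborel (\<lambda>s. exp (q * ln (q / b) - q) * exp ((\<sigma> + q) * s - a * exp s))"
    using integrable_gamma_kernel[OF q(2) assms(1)] by simp
  then show ?thesis
  proof (rule Bochner_Integration.integrable_bound)
    show "AE s in lborel. norm (exp (\<sigma> * s - a * exp s - b * exp (- s)))
        \<le> norm (exp (q * ln (q / b) - q) * exp ((\<sigma> + q) * s - a * exp s))"
    proof (rule AE_I2)
      fix s :: real
      show "norm (exp (\<sigma> * s - a * exp s - b * exp (- s)))
        \<le> norm (exp (q * ln (q / b) - q) * exp ((\<sigma> + q) * s - a * exp s))"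
        using exp_ge_tangent[OF b q(1), of "- s"] by (simp add: exp_add[symmetric] algebra_simps)
    qed
  qed measurable
qed

lemma integrable_bessel_kernel:
  assumes "Re \<xi> > 0" "Re c > 0 \<or> c = 0 \<and> Re \<nu> > 0"
  shows "integrable lborel (bessel_kernel \<nu> \<xi> c)"
proof (rule Bochner_Integration.integrable_bound)
  show "integrable lborel (\<lambda>s. exp (Re \<nu> * s - Re \<xi> * exp s - Re c * exp (- s)))"
    by (rule integrable_bessel_kernel_real) (use assms in auto)
qed (auto simp: norm_bessel_kernel)

text \<open>The sign of \<open>s\<close> decides which of the orders \<open>\<sigma> + 1\<close> and
  \<open>\<sigma> - 1\<close> is worse, and the sum covers both. The result is one majorant for a
  whole disc of parameters, as differentiation under the integral demands.\<close>

lemma norm_bessel_kernel_le: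
  assumes "\<bar>Re \<nu> - \<sigma>\<bar> \<le> 1" "a \<le> Re \<xi>" "b \<le> Re c"
  shows "norm (bessel_kernel \<nu> \<xi> c s) \<le>
    exp ((\<sigma> + 1) * s - a * exp s - b * exp (- s)) + exp ((\<sigma> - 1) * s - a * exp s - b * exp (- s))"
proof -
  have 1: "a * exp s \<le> Re \<xi> * exp s" "b * exp (- s) \<le> Re c * exp (- s)"
    using assms by (auto intro: mult_right_mono)
  have "norm (bessel_kernel \<nu> \<xi> c s) \<le> exp ((if s \<ge> 0 then \<sigma> + 1 else \<sigma> - 1) * s - a * exp s - b * exp (- s))"
  proof -
    have "Re \<nu> * s \<le> (if s \<ge> 0 then \<sigma> + 1 else \<sigma> - 1) * s"
      using assms by (auto intro: mult_right_mono mult_right_mono_neg)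
    then show ?thesis using 1 unfolding norm_bessel_kernel by (simp only: exp_le_cancel_iff)
  qed
  also have "\<dots> \<le> exp ((\<sigma> + 1) * s - a * exp s - b * exp (- s)) + exp ((\<sigma> - 1) * s - a * exp s - b * exp (- s))"
    by simp
  finally show ?thesis .
qed

section \<open>Parameter derivatives, the contiguous relation and symmetries of the integral\<close>

lemma bessel_integral_deriv_shift:
  assumes "Re \<xi> > 0" "Re c > 0"
  shows "((\<lambda>c. bessel_integral \<nu> \<xi> c) has_field_derivative - bessel_integral (\<nu> - 1) \<xi> c) (at c)"
proof -
  have "((\<lambda>z. \<integral>s. bessel_kernel \<nu> \<xi> z s \<partial>lborel) has_field_derivative
      (\<integral>s. - bessel_kernel (\<nu> - 1) \<xi> c s \<partial>lborel)) (at c)"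
  \<comment> \<open>On this disc \<open>Re z\<close> stays above half of \<open>Re c\<close>, so the
    decay at minus infinity does not degenerate.\<close>
  proof (rule has_field_derivative_integral[where r = "Re c / 2"])
    fix z s assume "z \<in> ball c (Re c / 2)"
    then have "Re c / 2 \<le> Re z"
      using abs_Re_le_cmod[of "c - z"] by (simp add: dist_norm)
    then show "norm (bessel_kernel \<nu> \<xi> z s) \<le> exp ((Re \<nu> + 1) * s - Re \<xi> * exp s - Re c / 2 * exp (- s))
        + exp ((Re \<nu> - 1) * s - Re \<xi> * exp s - Re c / 2 * exp (- s))"
      by (intro norm_bessel_kernel_le) auto
    show "((\<lambda>z. bessel_kernel \<nu> \<xi> z s) has_field_derivative - bessel_kernel (\<nu> - 1) \<xi> z s) (at z)"
      unfolding bessel_kernel_def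
      by (rule derivative_eq_intros refl)+ (simp add: bessel_kernel_shift(2)[unfolded bessel_kernel_def])
  next
    show "integrable lborel (\<lambda>s. exp ((Re \<nu> + 1) * s - Re \<xi> * exp s - Re c / 2 * exp (- s))
        + exp ((Re \<nu> - 1) * s - Re \<xi> * exp s - Re c / 2 * exp (- s)))"
      by (intro Bochner_Integration.integrable_add integrable_bessel_kernel_real) (use assms in auto)
  qed (use assms in auto)
  then show ?thesis by (simp add: bessel_integral_def)
qed

lemma bessel_integral_deriv_rate_0:
  assumes "Re \<xi> > 0" "Re \<nu> > 0"
  shows "((\<lambda>\<xi>. bessel_integral \<nu> \<xi> 0) has_field_derivative - bessel_integral (\<nu> + 1) \<xi> 0) (at \<xi>)"
proof -
  have "((\<lambda>z. \<integral>s. bessel_kernel \<nu> z 0 s \<partial>lborel) has_field_derivative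
      (\<integral>s. - bessel_kernel (\<nu> + 1) \<xi> 0 s \<partial>lborel)) (at \<xi>)"
  proof (rule has_field_derivative_integral[where r = "Re \<xi> / 2"])
    fix z s assume "z \<in> ball \<xi> (Re \<xi> / 2)"
    then have "Re \<xi> / 2 \<le> Re z"
      using abs_Re_le_cmod[of "\<xi> - z"] by (simp add: dist_norm)
    then show "norm (bessel_kernel \<nu> z 0 s) \<le> exp (Re \<nu> * s - Re \<xi> / 2 * exp s)"
      by (simp add: norm_bessel_kernel)
    show "((\<lambda>z. bessel_kernel \<nu> z 0 s) has_field_derivative - bessel_kernel (\<nu> + 1) z 0 s) (at z)"
      unfolding bessel_kernel_def
      by (rule derivative_eq_intros refl)+
        (use bessel_kernel_shift(1)[of \<nu> z 0 s] in \<open>simp add: bessel_kernel_def mult.commute\<close>)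
  next
    show "integrable lborel (\<lambda>s. exp (Re \<nu> * s - Re \<xi> / 2 * exp s))"
      by (intro integrable_gamma_kernel) (use assms in auto)
  qed (use assms in auto)
  then show ?thesis by (simp add: bessel_integral_def)
qed

lemma bessel_integral_holomorphic_order:
  assumes "Re \<xi> > 0" "Re c > 0"
  shows "(\<lambda>\<nu>. bessel_integral \<nu> \<xi> c) holomorphic_on A"
proof -
  have "((\<lambda>z. \<integral>s. bessel_kernel z \<xi> c s \<partial>lborel) has_field_derivative
      (\<integral>s. of_real s * bessel_kernel \<nu> \<xi> c s \<partial>lborel)) (at \<nu>)" for \<nu>
  proof (rule has_field_derivative_integral[where r = 1])
    fix z s assume "z \<in> ball \<nu> 1"
    then have "\<bar>Re z - Re \<nu>\<bar> \<le> 1"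
      using abs_Re_le_cmod[of "\<nu> - z"] by (simp add: dist_norm)
    then show "norm (bessel_kernel z \<xi> c s) \<le> exp ((Re \<nu> + 1) * s - Re \<xi> * exp s - Re c * exp (- s))
        + exp ((Re \<nu> - 1) * s - Re \<xi> * exp s - Re c * exp (- s))"
      by (intro norm_bessel_kernel_le) auto
    show "((\<lambda>z. bessel_kernel z \<xi> c s) has_field_derivative of_real s * bessel_kernel z \<xi> c s) (at z)"
      unfolding bessel_kernel_def by (rule derivative_eq_intros refl)+ simp
  next
    show "integrable lborel (\<lambda>s. exp ((Re \<nu> + 1) * s - Re \<xi> * exp s - Re c * exp (- s))
        + exp ((Re \<nu> - 1) * s - Re \<xi> * exp s - Re c * exp (- s)))"
      by (intro Bochner_Integration.integrable_add integrable_bessel_kernel_real) (use assms in auto)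
  qed (use assms in auto)
  then have "(\<lambda>\<nu>. bessel_integral \<nu> \<xi> c) field_differentiable at \<nu> within A" for \<nu>
    unfolding bessel_integral_def by (meson field_differentiable_at_within field_differentiable_def)
  then show ?thesis by (simp add: holomorphic_on_def)
qed

text \<open>The integrand belonging to the left side is the derivative of the kernel in
  \<open>s\<close>, and the kernel vanishes at both ends of the line.\<close>

lemma bessel_integral_recurrence:
  assumes "Re \<xi> > 0" "Re c > 0 \<or> c = 0 \<and> Re \<nu> > 0"
  shows "\<nu> * bessel_integral \<nu> \<xi> c - \<xi> * bessel_integral (\<nu> + 1) \<xi> c + c * bessel_integral (\<nu> - 1) \<xi> c = 0"
proof -
  let ?D = "\<lambda>s. \<nu> * bessel_kernel \<nu> \<xi> c s - \<xi> * bessel_kernel (\<nu> + 1) \<xi> c s + c * bessel_kernel (\<nu> - 1) \<xi> c s"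
  \<comment> \<open>For \<open>c = 0\<close> the kernel of order \<open>\<nu> - 1\<close> may fail
    to be integrable, but there its coefficient is zero.\<close>
  have int: "integrable lborel (\<lambda>s. \<nu> * bessel_kernel \<nu> \<xi> c s)"
      "integrable lborel (\<lambda>s. \<xi> * bessel_kernel (\<nu> + 1) \<xi> c s)"
      "integrable lborel (\<lambda>s. c * bessel_kernel (\<nu> - 1) \<xi> c s)"
    using integrable_bessel_kernel[OF assms(1), of c] assms(2) by auto
  have e: "einterval (-\<infinity>) \<infinity> = UNIV"
    by (auto simp: einterval_def)
  have deriv: "(bessel_kernel \<nu> \<xi> c has_vector_derivative ?D s) (at s)" for s
  proof -
    have "((\<lambda>s. exp (\<nu> * s - \<xi> * exp s - c * exp (- s))) has_field_derivative
        exp (\<nu> * s - \<xi> * exp s - c * exp (- s)) * (\<nu> - \<xi> * exp s + c * exp (- s))) (at s)" for s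
      by (rule derivative_eq_intros refl)+ simp
    from has_vector_derivative_real_field[OF this, of s UNIV] show ?thesis
      unfolding bessel_kernel_shift
      by (simp add: bessel_kernel_def [abs_def] exp_of_real [symmetric] algebra_simps)
  qed
  have top: "(bessel_kernel \<nu> \<xi> c \<longlongrightarrow> 0) at_top"
  proof (rule Lim_null_comparison)
    show "\<forall>\<^sub>F s in at_top. norm (bessel_kernel \<nu> \<xi> c s) \<le> exp (Re \<nu> * s - Re \<xi> * exp s)"
      using assms by (auto simp: norm_bessel_kernel)
    show "((\<lambda>s. exp (Re \<nu> * s - Re \<xi> * exp s)) \<longlongrightarrow> 0) at_top"
      using assms(1) by real_asymp
  qed
  have bot: "(bessel_kernel \<nu> \<xi> c \<longlongrightarrow> 0) at_bot"
  proof (cases "c = 0")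
    case True
    show ?thesis
    proof (rule Lim_null_comparison)
      show "\<forall>\<^sub>F s in at_bot. norm (bessel_kernel \<nu> \<xi> c s) \<le> exp (Re \<nu> * s)"
        using assms True by (auto simp: norm_bessel_kernel)
      have "Re \<nu> > 0" using assms True by auto
      then show "((\<lambda>s. exp (Re \<nu> * s)) \<longlongrightarrow> 0) at_bot"
        by real_asymp
    qed
  next
    case False
    show ?thesis
    proof (rule Lim_null_comparison)
      show "\<forall>\<^sub>F s in at_bot. norm (bessel_kernel \<nu> \<xi> c s) \<le> exp (Re \<nu> * s - Re c * exp (- s))"
        using assms by (auto simp: norm_bessel_kernel)
      have "Re c > 0" using assms False by auto
      then show "((\<lambda>s. exp (Re \<nu> * s - Re c * exp (- s))) \<longlongrightarrow> 0) at_bot"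
        by real_asymp
    qed
  qed
  have "(LBINT s=-\<infinity>..\<infinity>. ?D s) = 0 - 0"
  proof (rule interval_integral_FTC_integrable)
    show "isCont ?D s" for s
      using continuous_bessel_kernel[of UNIV]
      by (intro continuous_intros) (auto simp: continuous_on_eq_continuous_at)
    show "set_integrable lborel (einterval (-\<infinity>) \<infinity>) ?D"
      using int by (simp add: set_integrable_def e)
  qed (use deriv top bot in \<open>auto simp: ereal_tendsto_simps\<close>)
  then have "(\<integral>s. ?D s \<partial>lborel) = 0"
    by (simp add: interval_lebesgue_integral_def e set_lebesgue_integral_def)
  then show ?thesis
    using int by (simp add: bessel_integral_def)
qed

text \<open>The substitution of \<open>- s\<close> for \<open>s\<close>. It plays the part of the
  evenness of the Bessel function in its order.\<close>

lemma bessel_integral_reflect: "bessel_integral \<nu> \<xi> c = bessel_integral (- \<nu>) c \<xi>"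
proof -
  have "bessel_integral \<nu> \<xi> c = (\<integral>s. bessel_kernel \<nu> \<xi> c (0 + - 1 * s) \<partial>lborel)"
    unfolding bessel_integral_def by (subst lborel_integral_real_affine[of "- 1" _ 0]) auto
  also have "\<dots> = bessel_integral (- \<nu>) c \<xi>"
    unfolding bessel_integral_def
    by (rule Bochner_Integration.integral_cong) (simp_all add: bessel_kernel_def algebra_simps)
  finally show ?thesis .
qed

lemma bessel_integral_scale:
  assumes "x > 0"
  shows "bessel_integral \<nu> \<xi> c = of_real x powr \<nu> * bessel_integral \<nu> (\<xi> * of_real x) (c / of_real x)"
proof -
  have "bessel_integral \<nu> \<xi> c = (\<integral>s. bessel_kernel \<nu> \<xi> c (ln x + 1 * s) \<partial>lborel)"
    unfolding bessel_integral_def by (subst lborel_integral_real_affine[of 1 _ "ln x"]) auto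
  also have "(\<lambda>s. bessel_kernel \<nu> \<xi> c (ln x + 1 * s)) =
      (\<lambda>s. of_real x powr \<nu> * bessel_kernel \<nu> (\<xi> * of_real x) (c / of_real x) s)"
  proof
    fix s
    have e: "exp (ln x + 1 * s) = x * exp s" "exp (- (ln x + 1 * s)) = exp (- s) / x"
      using assms by (simp_all add: exp_add exp_diff exp_minus field_simps)
    show "bessel_kernel \<nu> \<xi> c (ln x + 1 * s) =
        of_real x powr \<nu> * bessel_kernel \<nu> (\<xi> * of_real x) (c / of_real x) s"
      using assms unfolding bessel_kernel_def e powr_def
      by (simp add: Ln_of_real exp_add [symmetric] algebra_simps flip: exp_of_real)
  qed
  finally show ?thesis by (simp add: bessel_integral_def)
qed

section \<open>The limit at \<open>c = 0\<close>: Gamma integrals\<close>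

lemma Gamma_conv_bessel_integral:
  assumes "Re \<nu> > 0"
  shows "bessel_integral \<nu> 1 0 = Gamma \<nu>"
proof -
  let ?F = "\<lambda>x::real. of_real x powr (\<nu> - 1) / of_real (exp x) :: complex"
  have F: "of_real (exp s) * ?F (exp s) = bessel_kernel \<nu> 1 0 s" for s
    by (simp add: bessel_kernel_def powr_def Ln_of_real exp_diff exp_of_real [symmetric] algebra_simps)
  have cont: "continuous_on {0<..} ?F"
    by (intro continuous_intros) auto
  have int: "integrable lborel (\<lambda>s. of_real (exp s) * ?F (exp s))"
    unfolding F by (rule integrable_bessel_kernel) (use assms in auto)
  have "bessel_integral \<nu> 1 0 = (LINT x:{0<..}|lborel. ?F x)"
    using exp_substitution(2)[OF cont int] by (simp only: F bessel_integral_def)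
  also have "\<dots> = integral {0<..} ?F"
    by (rule set_borel_integral_eq_integral(2)[OF exp_substitution(1)[OF cont int]])
  also have "\<dots> = Gamma \<nu>"
    by (rule integral_unique[OF Gamma_integral_complex'[OF assms]])
  finally show ?thesis .
qed

text \<open>By the recurrence \<open>z powr \<nu> * bessel_integral \<nu> z 0\<close> has derivative
  zero on the right half-plane, so its value at \<xi> is the one at 1. This replaces a rotation of
  the contour for complex \<xi>.\<close>

lemma bessel_integral_0:
  assumes "Re \<nu> > 0" "Re \<xi> > 0"
  shows "bessel_integral \<nu> \<xi> 0 = Gamma \<nu> * \<xi> powr (- \<nu>)"
proof -
  have "\<exists>k. \<forall>z\<in>{z. Re z > 0}. z powr \<nu> * bessel_integral \<nu> z 0 = k"
  proof (rule has_field_derivative_zero_constant)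
    show "convex {z. Re z > 0}" by (rule convex_halfspace_Re_gt)
    fix z assume "z \<in> {z. Re z > 0}"
    then have z: "Re z > 0" by simp
    have z': "z \<notin> \<real>\<^sub>\<le>\<^sub>0" using z complex_nonpos_Reals_iff by auto
    have "z powr \<nu> = z powr (\<nu> - 1) * z"
      using z by (auto simp: powr_diff)
    then have "\<nu> * z powr (\<nu> - 1) * bessel_integral \<nu> z 0 - z powr \<nu> * bessel_integral (\<nu> + 1) z 0 =
        z powr (\<nu> - 1) * (\<nu> * bessel_integral \<nu> z 0 - z * bessel_integral (\<nu> + 1) z 0)"
      by (simp add: algebra_simps)
    also have "\<dots> = 0"
      using bessel_integral_recurrence[OF z, of 0 \<nu>] assms by simp
    finally have "\<nu> * z powr (\<nu> - 1) * bessel_integral \<nu> z 0 - z powr \<nu> * bessel_integral (\<nu> + 1) z 0 = 0" .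
    then have "((\<lambda>z. z powr \<nu> * bessel_integral \<nu> z 0) has_field_derivative 0) (at z)"
      using DERIV_mult[OF has_field_derivative_powr[OF z', of \<nu>] bessel_integral_deriv_rate_0[OF z assms(1)]]
      by (simp add: algebra_simps)
    then show "((\<lambda>z. z powr \<nu> * bessel_integral \<nu> z 0) has_field_derivative 0) (at z within {z. Re z > 0})"
      by (rule has_field_derivative_at_within)
  qed
  then obtain k where "\<And>z. Re z > 0 \<Longrightarrow> z powr \<nu> * bessel_integral \<nu> z 0 = k"
    by auto
  from this[of \<xi>] this[of 1] have "\<xi> powr \<nu> * bessel_integral \<nu> \<xi> 0 = bessel_integral \<nu> 1 0"
    using assms by simp
  then show ?thesis
    using assms Gamma_conv_bessel_integral[OF assms(1)] by (cases "\<xi> = 0") (auto simp: powr_minus field_simps)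
qed

text \<open>For x > 0 the factor exp (- d x exp (- s)) has norm at most 1, so the Gamma kernel
  dominates. The free direction \<open>d\<close> lets the same limit serve after \<xi> and
  \<open>c\<close> have exchanged places.\<close>

lemma bessel_integral_tendsto_0:
  assumes "Re \<nu> > 0" "Re \<xi> > 0" "Re d > 0"
  shows "((\<lambda>x. bessel_integral \<nu> \<xi> (d * of_real x)) \<longlongrightarrow> Gamma \<nu> * \<xi> powr (- \<nu>)) (at_right 0)"
proof -
  have "(\<lambda>n. bessel_integral \<nu> \<xi> (d * of_real (X n))) \<longlonglongrightarrow> bessel_integral \<nu> \<xi> 0"
    if X: "\<And>n. X n > 0" and lim: "X \<longlonglongrightarrow> 0" for X :: "nat \<Rightarrow> real"
    unfolding bessel_integral_def
  proof (rule integral_dominated_convergence)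
    show "integrable lborel (\<lambda>s. exp (Re \<nu> * s - Re \<xi> * exp s))"
      by (rule integrable_gamma_kernel) (use assms in auto)
    show "AE s in lborel. (\<lambda>n. bessel_kernel \<nu> \<xi> (d * of_real (X n)) s) \<longlonglongrightarrow> bessel_kernel \<nu> \<xi> 0 s"
    proof (rule AE_I2)
      fix s
      have "(\<lambda>n. bessel_kernel \<nu> \<xi> (d * of_real (X n)) s) \<longlonglongrightarrow> bessel_kernel \<nu> \<xi> (d * of_real 0) s"
        unfolding bessel_kernel_def by (intro tendsto_intros lim)
      then show "(\<lambda>n. bessel_kernel \<nu> \<xi> (d * of_real (X n)) s) \<longlonglongrightarrow> bessel_kernel \<nu> \<xi> 0 s" by simp
    qed
    show "AE s in lborel. norm (bessel_kernel \<nu> \<xi> (d * of_real (X n)) s) \<le> exp (Re \<nu> * s - Re \<xi> * exp s)" for n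
      using X[of n] assms by (simp add: norm_bessel_kernel)
  qed auto
  then show ?thesis
    unfolding tendsto_at_iff_sequentially bessel_integral_0[OF assms(1,2), symmetric] by (auto simp: o_def)
qed

section \<open>The first order system and its constant determinants\<close>

text \<open>
  With \<open>E = c\<^bsup>1-\<nu>\<^esup> y\<^sub>1\<close> for the contiguous function \<open>y\<^sub>1 = - y'\<close>, the second order equation
  \<open>c y'' = \<xi> y + (\<nu> - 1) y'\<close> becomes a trace-free system, so the determinant of two solutions is constant.
\<close>

definition bessel_system :: "complex \<Rightarrow> complex \<Rightarrow> (complex \<Rightarrow> complex) \<Rightarrow> (complex \<Rightarrow> complex) \<Rightarrow> bool" where
  "bessel_system \<nu> \<xi> y E \<longleftrightarrow> (\<forall>c. Re c > 0 \<longrightarrow>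
     (y has_field_derivative - (c powr (\<nu> - 1)) * E c) (at c) \<and>
     (E has_field_derivative - \<xi> * c powr (- \<nu>) * y c) (at c))"

text \<open>The constant is evaluated on the positive axis near 0. The derivative of a solution may
  blow up there like \<open>c powr (\<nu> - 1)\<close>; \<open>E\<close> has this factor divided
  out, which makes finite limits possible.\<close>

lemma bessel_system_determinant:
  assumes "bessel_system \<nu> \<xi> y1 E1" "bessel_system \<nu> \<xi> y2 E2"
    and lims: "((\<lambda>x. y1 (of_real x)) \<longlongrightarrow> l1) (at_right 0)" "((\<lambda>x. E1 (of_real x)) \<longlongrightarrow> k1) (at_right 0)"
      "((\<lambda>x. y2 (of_real x)) \<longlongrightarrow> l2) (at_right 0)" "((\<lambda>x. E2 (of_real x)) \<longlongrightarrow> k2) (at_right 0)"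
    and "Re c > 0"
  shows "y1 c * E2 c - y2 c * E1 c = l1 * k2 - l2 * k1"
proof -
  have "\<exists>k. \<forall>c\<in>{c. Re c > 0}. y1 c * E2 c - y2 c * E1 c = k"
  proof (rule has_field_derivative_zero_constant)
    show "convex {z. Re z > 0}" by (rule convex_halfspace_Re_gt)
    fix c assume "c \<in> {c. Re c > 0}"
    then have c: "Re c > 0" by simp
    have "((\<lambda>c. y1 c * E2 c - y2 c * E1 c) has_field_derivative 0) (at c)"
      using assms(1,2) c unfolding bessel_system_def
      by (auto intro!: derivative_eq_intros simp: algebra_simps)
    then show "((\<lambda>c. y1 c * E2 c - y2 c * E1 c) has_field_derivative 0) (at c within {c. Re c > 0})"
      by (rule has_field_derivative_at_within)
  qed
  then obtain k where k: "\<And>c. Re c > 0 \<Longrightarrow> y1 c * E2 c - y2 c * E1 c = k" by auto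
  have "((\<lambda>x. y1 (of_real x) * E2 (of_real x) - y2 (of_real x) * E1 (of_real x)) \<longlongrightarrow> l1 * k2 - l2 * k1) (at_right 0)"
    by (intro tendsto_intros lims)
  moreover have "\<forall>\<^sub>F x in at_right 0. y1 (of_real x) * E2 (of_real x) - y2 (of_real x) * E1 (of_real x) = k"
    using eventually_at_right_less[of 0] by eventually_elim (simp add: k)
  ultimately have "((\<lambda>x::real. k) \<longlongrightarrow> l1 * k2 - l2 * k1) (at_right 0)"
    by (rule Lim_transform_eventually)
  then have "k = l1 * k2 - l2 * k1"
    by (simp add: tendsto_const_iff)
  with k[OF \<open>Re c > 0\<close>] show ?thesis by simp
qed

lemma tendsto_powr_at_right_0:
  assumes "Re \<mu> > 0"
  shows "((\<lambda>x::real. complex_of_real x powr \<mu>) \<longlongrightarrow> 0) (at_right 0)"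
proof (rule tendsto_norm_zero_cancel)
  have "((\<lambda>x::real. x powr Re \<mu>) \<longlongrightarrow> 0) (at_right 0)"
    using assms by real_asymp
  then show "((\<lambda>x::real. norm (complex_of_real x powr \<mu>)) \<longlongrightarrow> 0) (at_right 0)"
    by (rule Lim_transform_eventually)
      (use eventually_at_right_less[of 0] in \<open>eventually_elim, simp add: norm_powr_real_powr\<close>)
qed

lemma bessel_system_integral:
  assumes "Re \<xi> > 0"
  shows "bessel_system \<nu> \<xi> (\<lambda>c. bessel_integral \<nu> \<xi> c) (\<lambda>c. c powr (1 - \<nu>) * bessel_integral (\<nu> - 1) \<xi> c)"
  unfolding bessel_system_def
proof (intro allI impI conjI)
  fix c assume c: "Re c > 0"
  then have c': "c \<notin> \<real>\<^sub>\<le>\<^sub>0" "c \<noteq> 0" by (auto simp: complex_nonpos_Reals_iff)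
  have "c powr (\<nu> - 1) * c powr (1 - \<nu>) = 1"
    using c' by (simp add: powr_add [symmetric])
  with bessel_integral_deriv_shift[OF assms c, of \<nu>]
  show "((\<lambda>c. bessel_integral \<nu> \<xi> c) has_field_derivative
      - (c powr (\<nu> - 1)) * (c powr (1 - \<nu>) * bessel_integral (\<nu> - 1) \<xi> c)) (at c)"
    by (elim DERIV_cong) algebra
  have "((\<lambda>c. c powr (1 - \<nu>) * bessel_integral (\<nu> - 1) \<xi> c) has_field_derivative
      (1 - \<nu>) * c powr (1 - \<nu> - 1) * bessel_integral (\<nu> - 1) \<xi> c
      + - bessel_integral (\<nu> - 1 - 1) \<xi> c * c powr (1 - \<nu>)) (at c)"
    by (rule DERIV_mult[OF has_field_derivative_powr[OF c'(1)] bessel_integral_deriv_shift[OF assms c]])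
  moreover have "c powr (1 - \<nu>) = c powr (- \<nu>) * c"
    using c' by (simp add: powr_diff powr_minus field_simps)
  \<comment> \<open>The recurrence at order \<open>\<nu> - 1\<close> is the second order equation in
    disguise.\<close>
  moreover have "c * bessel_integral (\<nu> - 1 - 1) \<xi> c
      = \<xi> * bessel_integral \<nu> \<xi> c + (1 - \<nu>) * bessel_integral (\<nu> - 1) \<xi> c"
    using bessel_integral_recurrence[OF assms, of c "\<nu> - 1"] c by (simp add: algebra_simps)
  moreover have "c powr (1 - \<nu> - 1) = c powr (- \<nu>)" by simp
  ultimately show "((\<lambda>c. c powr (1 - \<nu>) * bessel_integral (\<nu> - 1) \<xi> c) has_field_derivative
      - \<xi> * c powr (- \<nu>) * bessel_integral \<nu> \<xi> c) (at c)"
    by (elim DERIV_cong) algebra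
qed

lemma bessel_series_deriv_scaled:
  "((\<lambda>c. bessel_series \<mu> (\<xi> * c)) has_field_derivative \<xi> * bessel_series (\<mu> + 1) (\<xi> * c)) (at c)"
  using DERIV_chain2[OF bessel_series_has_field_derivative DERIV_cmult_Id[of \<xi>]]
  by (simp only: mult.commute[of \<xi> "bessel_series _ _"])

text \<open>The Frobenius solution with exponent 0 at \<open>c = 0\<close>; the contiguous relation
  of the series takes the place of that of the integral.\<close>

lemma bessel_system_series_minus:
  "bessel_system \<nu> \<xi> (\<lambda>c. bessel_series (- \<nu>) (\<xi> * c)) (\<lambda>c. - \<xi> * (c powr (1 - \<nu>) * bessel_series (1 - \<nu>) (\<xi> * c)))"
  unfolding bessel_system_def
proof (intro allI impI conjI)
  fix c assume c: "Re c > 0"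
  then have c': "c \<notin> \<real>\<^sub>\<le>\<^sub>0" "c \<noteq> 0" by (auto simp: complex_nonpos_Reals_iff)
  have "c powr (\<nu> - 1) * c powr (1 - \<nu>) = 1"
    using c' by (simp add: powr_add [symmetric])
  moreover have "((\<lambda>c. bessel_series (- \<nu>) (\<xi> * c)) has_field_derivative
      \<xi> * bessel_series (1 - \<nu>) (\<xi> * c)) (at c)"
    using bessel_series_deriv_scaled[of "- \<nu>" \<xi> c] by simp
  ultimately show "((\<lambda>c. bessel_series (- \<nu>) (\<xi> * c)) has_field_derivative
      - (c powr (\<nu> - 1)) * (- \<xi> * (c powr (1 - \<nu>) * bessel_series (1 - \<nu>) (\<xi> * c)))) (at c)"
    by (elim DERIV_cong) algebra
  have "((\<lambda>c. - \<xi> * (c powr (1 - \<nu>) * bessel_series (1 - \<nu>) (\<xi> * c))) has_field_derivative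
      - \<xi> * ((1 - \<nu>) * c powr (1 - \<nu> - 1) * bessel_series (1 - \<nu>) (\<xi> * c)
      + \<xi> * bessel_series (1 - \<nu> + 1) (\<xi> * c) * c powr (1 - \<nu>))) (at c)"
    by (intro DERIV_cmult DERIV_mult[OF has_field_derivative_powr[OF c'(1)] bessel_series_deriv_scaled])
  moreover have "c powr (1 - \<nu>) = c powr (- \<nu>) * c"
    using c' by (simp add: powr_diff powr_minus field_simps)
  moreover have "bessel_series (- \<nu>) (\<xi> * c) = \<xi> * c * bessel_series (1 - \<nu> + 1) (\<xi> * c) + (1 - \<nu>) * bessel_series (1 - \<nu>) (\<xi> * c)"
    using bessel_series_recurrence[of "\<xi> * c" "1 - \<nu>"] by simp
  moreover have "c powr (1 - \<nu> - 1) = c powr (- \<nu>)" by simp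
  ultimately show "((\<lambda>c. - \<xi> * (c powr (1 - \<nu>) * bessel_series (1 - \<nu>) (\<xi> * c))) has_field_derivative
      - \<xi> * c powr (- \<nu>) * bessel_series (- \<nu>) (\<xi> * c)) (at c)"
    by (elim DERIV_cong) algebra
qed

text \<open>The Frobenius solution with exponent \<nu>. Its derivative carries exactly the factor
  \<open>c powr (\<nu> - 1)\<close>, so the second component is entire in \<open>c\<close>.\<close>

lemma bessel_system_series_plus:
  "bessel_system \<nu> \<xi> (\<lambda>c. c powr \<nu> * bessel_series \<nu> (\<xi> * c)) (\<lambda>c. - bessel_series (\<nu> - 1) (\<xi> * c))"
  unfolding bessel_system_def
proof (intro allI impI conjI)
  fix c assume c: "Re c > 0"
  then have c': "c \<notin> \<real>\<^sub>\<le>\<^sub>0" "c \<noteq> 0" by (auto simp: complex_nonpos_Reals_iff)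
  have "((\<lambda>c. c powr \<nu> * bessel_series \<nu> (\<xi> * c)) has_field_derivative
      \<nu> * c powr (\<nu> - 1) * bessel_series \<nu> (\<xi> * c) + \<xi> * bessel_series (\<nu> + 1) (\<xi> * c) * c powr \<nu>) (at c)"
    by (intro DERIV_mult[OF has_field_derivative_powr[OF c'(1)] bessel_series_deriv_scaled])
  moreover have "c powr \<nu> = c powr (\<nu> - 1) * c"
    using c' by (simp add: powr_diff)
  moreover have "bessel_series (\<nu> - 1) (\<xi> * c) = \<xi> * c * bessel_series (\<nu> + 1) (\<xi> * c) + \<nu> * bessel_series \<nu> (\<xi> * c)"
    using bessel_series_recurrence[of "\<xi> * c" \<nu>] by simp
  ultimately show "((\<lambda>c. c powr \<nu> * bessel_series \<nu> (\<xi> * c)) has_field_derivative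
      - (c powr (\<nu> - 1)) * - bessel_series (\<nu> - 1) (\<xi> * c)) (at c)"
    by (elim DERIV_cong) algebra
  have "c powr (- \<nu>) * c powr \<nu> = 1"
    using c' by (simp add: powr_add [symmetric])
  moreover have "((\<lambda>c. - bessel_series (\<nu> - 1) (\<xi> * c)) has_field_derivative
      - (\<xi> * bessel_series \<nu> (\<xi> * c))) (at c)"
    using DERIV_minus[OF bessel_series_deriv_scaled[of "\<nu> - 1" \<xi> c]] by simp
  ultimately show "((\<lambda>c. - bessel_series (\<nu> - 1) (\<xi> * c)) has_field_derivative
      - \<xi> * c powr (- \<nu>) * (c powr \<nu> * bessel_series \<nu> (\<xi> * c))) (at c)"
    by (elim DERIV_cong) algebra
qed

subsection \<open>Identification with the Bessel function of the second kind\<close>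

lemma bessel_integral_conv_series_strip:
  assumes \<nu>: "0 < Re \<nu>" "Re \<nu> < 1" and \<xi>: "Re \<xi> > 0" and c: "Re c > 0"
  shows "sin (of_real pi * \<nu>) / of_real pi * bessel_integral \<nu> \<xi> c =
    \<xi> powr (- \<nu>) * bessel_series (- \<nu>) (\<xi> * c) - c powr \<nu> * bessel_series \<nu> (\<xi> * c)"
proof -
  have series_lim: "((\<lambda>x. bessel_series \<mu> (\<xi> * of_real x)) \<longlongrightarrow> rGamma (\<mu> + 1)) (at_right 0)" for \<mu>
  proof -
    have "isCont (\<lambda>x. bessel_series \<mu> (\<xi> * of_real x)) 0"
      by (intro isCont_o2[OF _ DERIV_isCont[OF bessel_series_has_field_derivative]] continuous_intros)
    then show ?thesis
      unfolding isCont_def by (simp add: filterlim_at_split)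
  qed
  let ?y = "\<lambda>c. bessel_integral \<nu> \<xi> c" and ?E = "\<lambda>c. c powr (1 - \<nu>) * bessel_integral (\<nu> - 1) \<xi> c"
  let ?y1 = "\<lambda>c. bessel_series (- \<nu>) (\<xi> * c)" and ?E1 = "\<lambda>c. - \<xi> * (c powr (1 - \<nu>) * bessel_series (1 - \<nu>) (\<xi> * c))"
  let ?y2 = "\<lambda>c. c powr \<nu> * bessel_series \<nu> (\<xi> * c)" and ?E2 = "\<lambda>c. - bessel_series (\<nu> - 1) (\<xi> * c)"
  have y: "((\<lambda>x. ?y (of_real x)) \<longlongrightarrow> Gamma \<nu> * \<xi> powr (- \<nu>)) (at_right 0)"
    using bessel_integral_tendsto_0[OF \<nu>(1) \<xi>, of 1] by simp
  \<comment> \<open>The order \<open>\<nu> - 1\<close> has negative real part, so the limit at 0 is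
    not directly available. Reflecting and rescaling by \<open>1 / x\<close> absorbs the power in
    front and leaves an integral of order \<open>1 - \<nu>\<close>.\<close>
  have E: "((\<lambda>x. ?E (of_real x)) \<longlongrightarrow> Gamma (1 - \<nu>)) (at_right 0)"
  proof (rule Lim_transform_eventually)
    show "((\<lambda>x. bessel_integral (1 - \<nu>) 1 (\<xi> * of_real x)) \<longlongrightarrow> Gamma (1 - \<nu>)) (at_right 0)"
      using bessel_integral_tendsto_0[of "1 - \<nu>" 1 \<xi>] \<nu> \<xi> by simp
    show "\<forall>\<^sub>F x in at_right 0. bessel_integral (1 - \<nu>) 1 (\<xi> * of_real x) = ?E (of_real x)"
      using eventually_at_right_less[of 0]
    proof eventually_elim
      fix x :: real assume x: "0 < x"
      have "bessel_integral (\<nu> - 1) \<xi> (of_real x) = bessel_integral (1 - \<nu>) (of_real x) \<xi>"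
        by (subst bessel_integral_reflect) simp
      also have "\<dots> = of_real (1 / x) powr (1 - \<nu>) * bessel_integral (1 - \<nu>) 1 (\<xi> * of_real x)"
        using x bessel_integral_scale[of "1 / x" "1 - \<nu>" "of_real x" \<xi>] by simp
      also have "of_real (1 / x) powr (1 - \<nu>) = inverse (of_real x powr (1 - \<nu>))"
      proof -
        have "Ln (of_real (1 / x)) = - complex_of_real (ln x)"
          using x Ln_of_real[of "1 / x"] by (simp add: ln_div)
        then show ?thesis
          using x by (simp add: powr_def Ln_of_real exp_minus [symmetric] del: of_real_divide)
      qed
      finally show "bessel_integral (1 - \<nu>) 1 (\<xi> * of_real x) = ?E (of_real x)"
        using x by simp
    qed
  qed
  have y1: "((\<lambda>x. ?y1 (of_real x)) \<longlongrightarrow> rGamma (1 - \<nu>)) (at_right 0)"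
    using series_lim[of "- \<nu>"] by (simp add: add.commute)
  have E1: "((\<lambda>x. ?E1 (of_real x)) \<longlongrightarrow> - \<xi> * (0 * rGamma (1 - \<nu> + 1))) (at_right 0)"
    by (intro tendsto_intros series_lim tendsto_powr_at_right_0) (use \<nu> in auto)
  have y2: "((\<lambda>x. ?y2 (of_real x)) \<longlongrightarrow> 0 * rGamma (\<nu> + 1)) (at_right 0)"
    by (intro tendsto_intros series_lim tendsto_powr_at_right_0) (use \<nu> in auto)
  have E2: "((\<lambda>x. ?E2 (of_real x)) \<longlongrightarrow> - rGamma \<nu>) (at_right 0)"
    using tendsto_minus[OF series_lim[of "\<nu> - 1"]] by simp
  note sys = bessel_system_integral[OF \<xi>, of \<nu>] bessel_system_series_minus[of \<nu> \<xi>] bessel_system_series_plus[of \<nu> \<xi>]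
  have "z \<notin> \<int>\<^sub>\<le>\<^sub>0" if "Re z > 0" for z
    using that by (auto elim!: nonpos_Ints_cases)
  then have nonpole: "\<nu> \<notin> \<int>\<^sub>\<le>\<^sub>0" "1 - \<nu> \<notin> \<int>\<^sub>\<le>\<^sub>0"
    using \<nu> by auto
  \<comment> \<open>In the determinants with the integral, products of \<open>Gamma\<close> and
    \<open>rGamma\<close> collapse to 1; the determinant of the two series is the reflection
    formula.\<close>
  have "?y c * ?E1 c - ?y1 c * ?E c = - 1"
    using bessel_system_determinant[OF sys(1,2) y E y1 E1 c] nonpole(2) by (simp add: rGamma_inverse_Gamma Gamma_eq_zero_iff)
  moreover have "?y c * ?E2 c - ?y2 c * ?E c = - (\<xi> powr (- \<nu>))"
    using bessel_system_determinant[OF sys(1,3) y E y2 E2 c] nonpole(1) by (simp add: rGamma_inverse_Gamma Gamma_eq_zero_iff)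
  moreover have "?y1 c * ?E2 c - ?y2 c * ?E1 c = - (sin (of_real pi * \<nu>) / of_real pi)"
    using bessel_system_determinant[OF sys(2,3) y1 E1 y2 E2 c] rGamma_reflection_complex[of \<nu>] by (simp add: mult.commute)
  \<comment> \<open>With all functions taken at \<open>c\<close>, \<open>?y * (?y1 * ?E2 - ?y2 *
    ?E1) = ?y1 * (?y * ?E2 - ?y2 * ?E) - ?y2 * (?y * ?E1 - ?y1 * ?E)\<close>; inserting the three
    constants gives the claim.\<close>
  ultimately show ?thesis by algebra
qed

text \<open>Both sides are entire in \<nu>, so agreement on the strip suffices. At integer \<nu> the
  sine vanishes and the relation only says that the two series terms coincide; the value of the
  integral there has to come from a limit.\<close>

theorem bessel_integral_conv_series:
  assumes "Re \<xi> > 0" "Re c > 0"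
  shows "sin (of_real pi * \<nu>) / of_real pi * bessel_integral \<nu> \<xi> c =
    \<xi> powr (- \<nu>) * bessel_series (- \<nu>) (\<xi> * c) - c powr \<nu> * bessel_series \<nu> (\<xi> * c)"
proof (rule analytic_continuation_open[where s = "{\<nu>. 0 < Re \<nu>} \<inter> {\<nu>. Re \<nu> < 1}" and s' = UNIV
      and f = "\<lambda>\<nu>. sin (of_real pi * \<nu>) / of_real pi * bessel_integral \<nu> \<xi> c"])
  show "open ({\<nu>. 0 < Re \<nu>} \<inter> {\<nu>. Re \<nu> < 1})"
    by (intro open_Int open_halfspace_Re_gt open_halfspace_Re_lt)
  have "of_real (1 / 2) \<in> {\<nu>. 0 < Re \<nu>} \<inter> {\<nu>. Re \<nu> < 1}" by simp
  then show "{\<nu>. 0 < Re \<nu>} \<inter> {\<nu>. Re \<nu> < 1} \<noteq> {}" by blast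
  have "\<xi> \<noteq> 0" "c \<noteq> 0" using assms by auto
  then show "(\<lambda>\<nu>. \<xi> powr (- \<nu>) * bessel_series (- \<nu>) (\<xi> * c) - c powr \<nu> * bessel_series \<nu> (\<xi> * c)) holomorphic_on UNIV"
    unfolding powr_def by (simp, intro holomorphic_intros)
  show "sin (of_real pi * z) / of_real pi * bessel_integral z \<xi> c =
      \<xi> powr (- z) * bessel_series (- z) (\<xi> * c) - c powr z * bessel_series z (\<xi> * c)"
    if "z \<in> {\<nu>. 0 < Re \<nu>} \<inter> {\<nu>. Re \<nu> < 1}" for z
    using that assms by (intro bessel_integral_conv_series_strip) auto
qed (use assms in \<open>auto intro!: holomorphic_intros bessel_integral_holomorphic_order\<close>)

section \<open>Principal branches and the Bessel function of the second kind\<close>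

lemma Ln_times_Re_pos:
  assumes "Re x > 0" "Re y > 0"
  shows "Ln (x * y) = Ln x + Ln y"
proof -
  have "\<bar>Im (Ln x)\<bar> < pi / 2" "\<bar>Im (Ln y)\<bar> < pi / 2" "x \<noteq> 0" "y \<noteq> 0"
    using assms Re_Ln_pos_lt_imp by auto
  then show ?thesis by (intro Ln_times_simple) linarith+
qed

lemma Ln_divide_Re_pos:
  assumes "Re x > 0" "Re y > 0"
  shows "Ln (x / y) = Ln x - Ln y"
proof -
  have "y \<notin> \<real>\<^sub>\<le>\<^sub>0" using assms by (auto simp: complex_nonpos_Reals_iff)
  moreover have "Re (inverse y) > 0"
    using assms by (simp add: Re_complex_div_gt_0 inverse_eq_divide)
  ultimately show ?thesis
    using Ln_times_Re_pos[of x "inverse y"] assms by (simp add: divide_inverse Ln_inverse)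
qed

text \<open>The exponential factor, a branch of \<xi> / c to the power \<nu> / 2, turns
  \<open>\<xi> powr (- \<nu>)\<close> and \<open>c powr \<nu>\<close> into powers of
  \<open>csqrt (\<xi> * c)\<close> with exponents \<open>- \<nu>\<close> and \<nu>. These are the
  branch factors of \<open>bessel_I\<close>.\<close>

lemma bessel_K_quotient_conv_integral:
  assumes "Re \<xi> > 0" "Re c > 0" "\<nu> \<notin> \<int>"
  shows "bessel_K_quotient \<nu> (2 * csqrt (\<xi> * c)) = exp (\<nu> * (Ln \<xi> - Ln c) / 2) * bessel_integral \<nu> \<xi> c / 2"
proof -
  have nz: "\<xi> \<noteq> 0" "c \<noteq> 0" using assms by auto
  have pow: "csqrt (\<xi> * c) powr \<mu> = exp (\<mu> * (Ln \<xi> + Ln c) / 2)" for \<mu>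
  proof -
    have "\<bar>Im (Ln \<xi>)\<bar> < pi / 2" "\<bar>Im (Ln c)\<bar> < pi / 2"
      using assms Re_Ln_pos_lt_imp nz by auto
    \<comment> \<open>Half the sum of two arguments below pi / 2 stays in the range where
      \<open>Ln\<close> inverts \<open>exp\<close>, so powers of the root become exponentials of
      logarithms.\<close>
    then have "- pi < (Im (Ln \<xi>) + Im (Ln c)) / 2" "(Im (Ln \<xi>) + Im (Ln c)) / 2 \<le> pi"
      by (auto simp: abs_less_iff)
    then have "Ln (exp ((Ln \<xi> + Ln c) / 2)) = (Ln \<xi> + Ln c) / 2"
      by (intro Ln_exp) simp_all
    moreover have "csqrt (\<xi> * c) = exp ((Ln \<xi> + Ln c) / 2)"
      using nz by (simp add: csqrt_exp_Ln Ln_times_Re_pos assms)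
    ultimately show ?thesis by (simp only: powr_def) simp
  qed
  have sin_nz: "sin (of_real pi * \<nu>) \<noteq> 0"
  proof
    assume "sin (of_real pi * \<nu>) = 0"
    then obtain n :: int where "of_real pi * \<nu> = of_real (of_int n * pi)"
      unfolding sin_eq_0 by blast
    then have "\<nu> = of_int n" by (simp add: mult.commute)
    with assms(3) show False by simp
  qed
  let ?S = "\<lambda>\<mu>. bessel_series \<mu> (\<xi> * c)"
  have "exp (\<nu> * (Ln \<xi> - Ln c) / 2) * (\<xi> powr (- \<nu>) * ?S (- \<nu>) - c powr \<nu> * ?S \<nu>)
      = exp (\<nu> * (Ln \<xi> - Ln c) / 2 - \<nu> * Ln \<xi>) * ?S (- \<nu>) - exp (\<nu> * (Ln \<xi> - Ln c) / 2 + \<nu> * Ln c) * ?S \<nu>"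
  proof -
    have "\<xi> powr (- \<nu>) = inverse (exp (\<nu> * Ln \<xi>))" "c powr \<nu> = exp (\<nu> * Ln c)"
      using nz by (simp_all add: powr_def exp_minus)
    then show ?thesis
      unfolding exp_add exp_diff by (simp only: divide_inverse right_diff_distrib mult.assoc)
  qed
  also have "\<nu> * (Ln \<xi> - Ln c) / 2 - \<nu> * Ln \<xi> = - \<nu> * (Ln \<xi> + Ln c) / 2"
    by (simp add: field_simps)
  also have "\<nu> * (Ln \<xi> - Ln c) / 2 + \<nu> * Ln c = \<nu> * (Ln \<xi> + Ln c) / 2"
    by (simp add: field_simps)
  finally have "bessel_I (- \<nu>) (2 * csqrt (\<xi> * c)) - bessel_I \<nu> (2 * csqrt (\<xi> * c)) =
      exp (\<nu> * (Ln \<xi> - Ln c) / 2) * (sin (of_real pi * \<nu>) / of_real pi * bessel_integral \<nu> \<xi> c)"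
    unfolding bessel_integral_conv_series[OF assms(1,2)] by (simp add: bessel_I_eq pow)
  then show ?thesis
    using sin_nz by (simp add: bessel_K_quotient_def)
qed

theorem bessel_K_conv_integral:
  assumes "Re \<xi> > 0" "Re c > 0"
  shows "bessel_K \<nu> (2 * csqrt (\<xi> * c)) = exp (\<nu> * (Ln \<xi> - Ln c) / 2) * bessel_integral \<nu> \<xi> c / 2"
proof (cases "\<nu> \<in> \<int>")
  case False
  then show ?thesis by (simp add: bessel_K_def bessel_K_quotient_conv_integral assms)
next
  case True
  let ?h = "\<lambda>\<mu>. exp (\<mu> * (Ln \<xi> - Ln c) / 2) * bessel_integral \<mu> \<xi> c / 2"
  have "?h holomorphic_on UNIV"
    by (intro holomorphic_intros bessel_integral_holomorphic_order assms) auto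
  then have "isCont ?h \<nu>"
    using holomorphic_on_imp_continuous_on continuous_on_eq_continuous_at by blast
  then have lim: "(?h \<longlongrightarrow> ?h \<nu>) (at \<nu>)"
    by (simp add: isCont_def)
  \<comment> \<open>Distinct integers are at distance at least 1, so on a punctured unit disc around
    \<nu> the quotient agrees with the continuous function \<open>?h\<close>.\<close>
  have "\<mu> \<notin> \<int>" if "\<mu> \<noteq> \<nu>" "dist \<mu> \<nu> < 1" for \<mu>
  proof
    assume "\<mu> \<in> \<int>"
    with True obtain n :: int where "\<mu> - \<nu> = of_int n"
      by (meson Ints_cases Ints_diff)
    moreover from this that(2) have "\<bar>real_of_int n\<bar> < 1"
      by (simp add: dist_norm)
    then have "n = 0" by linarith
    ultimately show False using that(1) by simp
  qed
  then have "\<forall>\<^sub>F \<mu> in at \<nu>. ?h \<mu> = bessel_K_quotient \<mu> (2 * csqrt (\<xi> * c))"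
    unfolding eventually_at using bessel_K_quotient_conv_integral[OF assms]
    by (intro exI[of _ 1]) auto
  from Lim_transform_eventually[OF lim this]
  have "Lim (at \<nu>) (\<lambda>\<mu>. bessel_K_quotient \<mu> (2 * csqrt (\<xi> * c))) = ?h \<nu>"
    by (intro tendsto_Lim) auto
  then show ?thesis using True by (simp add: bessel_K_def)
qed

text \<open>For negative \<delta> exchange \<xi> and \<open>c\<close> and use the order
  \<open>- \<delta>\<close>: the root and the exponential factor are unchanged, and reflection
  restores the integral.\<close>

lemma bessel_K_abs_conv_integral:
  assumes "Re \<xi> > 0" "Re c > 0"
  shows "bessel_K (of_real \<bar>\<delta>\<bar>) (2 * csqrt (\<xi> * c)) =
    exp (of_real \<delta> * (Ln \<xi> - Ln c) / 2) * bessel_integral (of_real \<delta>) \<xi> c / 2"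
proof (cases "\<delta> \<ge> 0")
  case True
  then show ?thesis using bessel_K_conv_integral[OF assms] by simp
next
  case False
  have "bessel_integral (- of_real \<delta>) c \<xi> = bessel_integral (of_real \<delta>) \<xi> c"
    by (subst bessel_integral_reflect) simp
  then show ?thesis
    using False bessel_K_conv_integral[OF assms(2,1), of "- of_real \<delta>"]
    by (simp add: mult.commute[of c] minus_mult_left[symmetric] algebra_simps)
qed

lemma bessel_integral_conv_K:
  assumes "Re \<xi> > 0" "Re \<eta> > 0" "t > 0"
  shows "bessel_integral (of_real \<delta>) \<xi> (of_real t * \<eta>) =
    2 * ((\<eta> / \<xi>) powr of_real (\<delta> / 2) * of_real (t powr (\<delta> / 2)) *
      bessel_K (of_real \<bar>\<delta>\<bar>) (2 * csqrt (of_real t * \<xi> * \<eta>)))"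
proof -
  have c: "Re (of_real t * \<eta>) > 0" using assms by simp
  have nz: "\<eta> / \<xi> \<noteq> 0" using assms by auto
  have "(\<eta> / \<xi>) powr of_real (\<delta> / 2) * of_real (t powr (\<delta> / 2))
      = exp (of_real (\<delta> / 2) * (Ln \<eta> - Ln \<xi>) + of_real (\<delta> / 2 * ln t))"
    using assms nz unfolding exp_add powr_def Ln_divide_Re_pos[OF assms(2,1)]
    by (simp flip: exp_of_real)
  also have "\<dots> = exp (- (of_real \<delta> * (Ln \<xi> - Ln (of_real t * \<eta>)) / 2))"
    using assms by (intro arg_cong[where f = exp]) (simp add: Ln_times_Re_pos Ln_of_real diff_divide_distrib add_divide_distrib ring_distribs)
  finally have e: "(\<eta> / \<xi>) powr of_real (\<delta> / 2) * of_real (t powr (\<delta> / 2))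
      = exp (- (of_real \<delta> * (Ln \<xi> - Ln (of_real t * \<eta>)) / 2))" .
  have "of_real t * \<xi> * \<eta> = \<xi> * (of_real t * \<eta>)" by simp
  then show ?thesis
    unfolding e by (simp only: bessel_K_abs_conv_integral[OF assms(1) c]) (simp add: exp_minus)
qed

subsection \<open>The density of the product\<close>

lemma set_integral_conv_bessel_integral:
  fixes \<delta> :: real
  assumes "Re \<xi> > 0" "Re c > 0"
  defines "F \<equiv> \<lambda>x::real. of_real (x powr (\<delta> - 1)) * exp (- \<xi> * of_real x - c / of_real x)"
  shows "set_integrable lborel {0<..} F"
    and "(LINT x:{0<..}|lborel. F x) = bessel_integral (of_real \<delta>) \<xi> c"
proof -
  have kernel: "of_real (exp s) * F (exp s) = bessel_kernel (of_real \<delta>) \<xi> c s" for s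
  proof -
    have "exp s * exp s powr (\<delta> - 1) = exp (\<delta> * s)"
      by (simp add: powr_def exp_add [symmetric] algebra_simps)
    then have "of_real (exp s) * F (exp s) = of_real (exp (\<delta> * s)) * exp (- \<xi> * of_real (exp s) - c / of_real (exp s))"
      by (simp add: F_def flip: of_real_mult mult.assoc)
    also have "\<dots> = bessel_kernel (of_real \<delta>) \<xi> c s"
    proof -
      have "c / complex_of_real (exp s) = c * of_real (exp (- s))"
        by (simp add: exp_minus divide_inverse)
      moreover have "complex_of_real (exp (\<delta> * s)) = exp (of_real \<delta> * of_real s)"
        by (metis exp_of_real of_real_mult)
      ultimately show ?thesis
        unfolding bessel_kernel_def by (simp only: exp_add [symmetric]) (simp add: algebra_simps)
    qed
    finally show ?thesis .
  qed
  have cont: "continuous_on {0<..} F"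
    unfolding F_def by (intro continuous_intros) auto
  have int: "integrable lborel (\<lambda>s. of_real (exp s) * F (exp s))"
    unfolding kernel by (rule integrable_bessel_kernel) (use assms in auto)
  show "set_integrable lborel {0<..} F"
    by (rule exp_substitution(1)[OF cont int])
  show "(LINT x:{0<..}|lborel. F x) = bessel_integral (of_real \<delta>) \<xi> c"
    using exp_substitution(2)[OF cont int] by (simp only: kernel bessel_integral_def)
qed

text \<open>After expanding the product of the sums, each term carries
  \<open>t powr (\<beta> - 1) * x powr (\<alpha> - \<beta> - 1)\<close> times an exponential in
  \<open>x\<close> and \<open>t / x\<close>, and is therefore a Bessel integral of order
  \<open>\<alpha> - \<beta>\<close>.\<close>

lemma product_density_exponential_sums:
  fixes f g :: "real \<Rightarrow> real" and \<alpha> \<beta> t :: real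
  assumes t: "t > 0"
    and \<xi>: "\<And>m. m \<in> A \<Longrightarrow> Re (\<xi> m) > 0" and \<eta>: "\<And>n. n \<in> B \<Longrightarrow> Re (\<eta> n) > 0"
    and f: "\<And>x. x > 0 \<Longrightarrow> complex_of_real (f x) =
        of_real (x powr (\<alpha> - 1)) * (\<Sum>m\<in>A. a m * exp (- \<xi> m * of_real x))"
    and g: "\<And>y. y > 0 \<Longrightarrow> complex_of_real (g y) =
        of_real (y powr (\<beta> - 1)) * (\<Sum>n\<in>B. b n * exp (- \<eta> n * of_real y))"
  shows "set_integrable lborel {0<..} (\<lambda>x. f x * g (t / x) * (1 / x))"
    and "complex_of_real (product_density f g t) = of_real (t powr (\<beta> - 1)) *
      (\<Sum>m\<in>A. \<Sum>n\<in>B. a m * b n * bessel_integral (of_real (\<alpha> - \<beta>)) (\<xi> m) (of_real t * \<eta> n))"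
proof -
  define F where "F = (\<lambda>m n x. of_real (x powr (\<alpha> - \<beta> - 1)) * exp (- \<xi> m * of_real x - of_real t * \<eta> n / of_real x))"
  define h where "h = (\<lambda>x. f x * g (t / x) * (1 / x))"
  have h: "complex_of_real (h x) = of_real (t powr (\<beta> - 1)) * (\<Sum>m\<in>A. \<Sum>n\<in>B. a m * b n * F m n x)" if x: "x > 0" for x
  proof -
    have "x powr (\<alpha> - 1) * (t / x) powr (\<beta> - 1) * (1 / x) = t powr (\<beta> - 1) * x powr (\<alpha> - \<beta> - 1)"
    proof -
      have "x powr (\<alpha> - 1) = x powr (\<alpha> - \<beta> - 1) * x powr (\<beta> - 1) * x powr 1"
        by (simp only: powr_add [symmetric]) simp
      then show ?thesis using t x by (simp add: powr_divide)
    qed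
    then have p: "complex_of_real (x powr (\<alpha> - 1)) * of_real ((t / x) powr (\<beta> - 1)) * of_real (1 / x)
        = of_real (t powr (\<beta> - 1)) * of_real (x powr (\<alpha> - \<beta> - 1))"
      by (simp only: of_real_mult [symmetric])
    let ?S = "(\<Sum>m\<in>A. a m * exp (- \<xi> m * of_real x))" and ?T = "(\<Sum>n\<in>B. b n * exp (- \<eta> n * of_real (t / x)))"
    have "complex_of_real (h x) = complex_of_real (f x) * of_real (g (t / x)) * of_real (1 / x)"
      by (simp add: h_def)
    also have "\<dots> = of_real (x powr (\<alpha> - 1)) * ?S * (of_real ((t / x) powr (\<beta> - 1)) * ?T) * of_real (1 / x)"
      using f[OF x] g[of "t / x"] t x by (simp only: divide_pos_pos)
    also have "\<dots> = (of_real (x powr (\<alpha> - 1)) * of_real ((t / x) powr (\<beta> - 1)) * of_real (1 / x)) * (?S * ?T)"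
      by (simp only: mult_ac)
    also have "\<dots> = of_real (t powr (\<beta> - 1)) * (of_real (x powr (\<alpha> - \<beta> - 1)) * (?S * ?T))"
      unfolding p by (simp only: mult.assoc)
    also have "of_real (x powr (\<alpha> - \<beta> - 1)) * (?S * ?T) = (\<Sum>m\<in>A. \<Sum>n\<in>B. a m * b n * F m n x)"
      unfolding sum_product unfolding sum_distrib_left
      by (intro sum.cong refl) (simp add: F_def exp_diff exp_minus divide_inverse mult_ac)
    finally show ?thesis .
  qed
  have F_int: "set_integrable lborel {0<..} (F m n)"
    and F_eq: "(LINT x:{0<..}|lborel. F m n x) = bessel_integral (of_real (\<alpha> - \<beta>)) (\<xi> m) (of_real t * \<eta> n)"
    if "m \<in> A" "n \<in> B" for m n
    using set_integral_conv_bessel_integral[of "\<xi> m" "of_real t * \<eta> n" "\<alpha> - \<beta>"] \<xi>[OF that(1)] \<eta>[OF that(2)] t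
    by (auto simp: F_def)
  \<comment> \<open>Single terms may be complex while \<open>f\<close> and \<open>g\<close> are
    real. Their combination \<open>H\<close> agrees with the real integrand on the positive axis, so
    integrability of that integrand follows by taking real parts.\<close>
  define H where "H = (\<lambda>x. of_real (t powr (\<beta> - 1)) * (\<Sum>m\<in>A. \<Sum>n\<in>B. a m * b n * F m n x))"
  have ind: "indicator {0<..} x *\<^sub>R H x = of_real (t powr (\<beta> - 1)) * (\<Sum>m\<in>A. \<Sum>n\<in>B. a m * b n * (indicator {0<..} x *\<^sub>R F m n x))" for x :: real
    by (simp add: H_def indicator_def)
  have ind_h: "complex_of_real (indicator {0<..} x *\<^sub>R h x) = indicator {0<..} x *\<^sub>R H x" for x :: real
    using h[of x] by (simp add: H_def indicator_def)
  have H_int: "integrable lborel (\<lambda>x. indicator {0<..} x *\<^sub>R H x)"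
    unfolding ind using F_int
    by (intro integrable_mult_right Bochner_Integration.integrable_sum) (auto simp: set_integrable_def)
  show "set_integrable lborel {0<..} (\<lambda>x. f x * g (t / x) * (1 / x))"
    unfolding h_def [symmetric] set_integrable_def
    using integrable_Re[OF H_int] by (simp add: ind_h [symmetric])
  have "complex_of_real (product_density f g t) = (\<integral>x. complex_of_real (indicator {0<..} x *\<^sub>R h x) \<partial>lborel)"
    unfolding product_density_def set_lebesgue_integral_def h_def by (simp only: integral_complex_of_real)
  also have "\<dots> = (\<integral>x. indicator {0<..} x *\<^sub>R H x \<partial>lborel)"
    by (simp only: ind_h)
  also have "\<dots> = of_real (t powr (\<beta> - 1)) *
      (\<Sum>m\<in>A. \<Sum>n\<in>B. a m * b n * (\<integral>x. indicator {0<..} x *\<^sub>R F m n x \<partial>lborel))"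
  proof -
    have "(\<integral>x. k * (\<Sum>m\<in>A. \<Sum>n\<in>B. a m * b n * G m n x) \<partial>lborel) =
        k * (\<Sum>m\<in>A. \<Sum>n\<in>B. a m * b n * (\<integral>x. G m n x \<partial>lborel))"
      if "\<And>m n. m \<in> A \<Longrightarrow> n \<in> B \<Longrightarrow> integrable lborel (G m n)" for k and G :: "_ \<Rightarrow> _ \<Rightarrow> real \<Rightarrow> complex"
      using that by (simp add: Bochner_Integration.integral_sum)
    then show ?thesis
      unfolding ind by this (use F_int in \<open>simp add: set_integrable_def\<close>)
  qed
  also have "\<dots> = of_real (t powr (\<beta> - 1)) *
      (\<Sum>m\<in>A. \<Sum>n\<in>B. a m * b n * bessel_integral (of_real (\<alpha> - \<beta>)) (\<xi> m) (of_real t * \<eta> n))"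
    using F_eq by (simp add: set_lebesgue_integral_def)
  finally show "complex_of_real (product_density f g t) = \<dots>" .
qed

section \<open>The law of a product of independent variables\<close>

lemma borel_measurable_of_ennreal:
  assumes "(\<lambda>x. ennreal (f x)) \<in> borel_measurable M" "\<And>x. 0 \<le> f x"
  shows "f \<in> borel_measurable M"
proof -
  have "(\<lambda>x. enn2real (ennreal (f x))) \<in> borel_measurable M"
    using assms(1) by measurable
  then show ?thesis using assms(2) by simp
qed

text \<open>For fixed x > 0 the substitution y = t / x in the joint density contributes
  \<open>1 / x\<close>, and exchanging the integrals leaves the density inside. The hypothesis
  \<open>int\<close> ensures that the Bochner integral in \<open>product_density\<close> is the
  nonnegative integral and not the default 0.\<close>

lemma (in prob_space) distributed_product:
  fixes X Y f g :: "_ \<Rightarrow> real"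
  assumes indep: "indep_var borel X borel Y"
    and X: "distributed M lborel X (\<lambda>x. ennreal (f x))" and Y: "distributed M lborel Y (\<lambda>y. ennreal (g y))"
    and nonneg: "\<And>x. 0 \<le> f x" "\<And>y. 0 \<le> g y"
    and supp: "\<And>x. x < 0 \<Longrightarrow> f x = 0" "\<And>y. y < 0 \<Longrightarrow> g y = 0"
    and int: "\<And>t. t > 0 \<Longrightarrow> set_integrable lborel {0<..} (\<lambda>x. f x * g (t / x) * (1 / x))"
  shows "distributed M lborel (\<lambda>\<omega>. X \<omega> * Y \<omega>) (\<lambda>t. ennreal (product_density f g t))"
proof -
  have f [measurable]: "f \<in> borel_measurable borel" and g [measurable]: "g \<in> borel_measurable borel"
    using borel_measurable_of_ennreal[of f borel] borel_measurable_of_ennreal[of g borel] nonneg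
      distributed_borel_measurable[OF X] distributed_borel_measurable[OF Y] by auto
  have [measurable]: "random_variable borel X" "random_variable borel Y"
    using indep by (auto simp: indep_var_rv1 indep_var_rv2)
  have dens [measurable]: "product_density f g \<in> borel_measurable borel"
    unfolding product_density_def [abs_def] set_lebesgue_integral_def
    by (rule lborel.borel_measurable_lebesgue_integral) measurable
  have joint: "distr M (lborel \<Otimes>\<^sub>M lborel) (\<lambda>\<omega>. (X \<omega>, Y \<omega>)) =
      density (lborel \<Otimes>\<^sub>M lborel) (\<lambda>(x, y). ennreal (f x) * ennreal (g y))"
  proof -
    have "indep_var lborel X lborel Y"
      using indep by (simp add: indep_var_eq)
    from distributed_joint_indep[OF lborel.sigma_finite_measure_axioms lborel.sigma_finite_measure_axioms X Y this]
    show ?thesis by (simp add: distributed_def)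
  qed
  \<comment> \<open>For \<open>t < 0\<close> and \<open>x > 0\<close> the value
    \<open>g (t / x)\<close> vanishes, so both sides are zero; \<open>t = 0\<close> is a null
    set.\<close>
  have dens_eq: "AE t in lborel. (\<integral>\<^sup>+x. ennreal (f x) * indicator {0<..} x * (ennreal (g (t / x)) * ennreal (1 / x)) \<partial>lborel)
      = ennreal (product_density f g t)"
    using AE_lborel_singleton[of 0]
  proof eventually_elim
    fix t :: real assume "t \<noteq> 0"
    then consider "t > 0" | "t < 0" by linarith
    then show "(\<integral>\<^sup>+x. ennreal (f x) * indicator {0<..} x * (ennreal (g (t / x)) * ennreal (1 / x)) \<partial>lborel)
      = ennreal (product_density f g t)"
    proof cases
      case 1
      have "(\<integral>\<^sup>+x. ennreal (f x) * indicator {0<..} x * (ennreal (g (t / x)) * ennreal (1 / x)) \<partial>lborel)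
          = (\<integral>\<^sup>+x. ennreal (indicator {0<..} x *\<^sub>R (f x * g (t / x) * (1 / x))) \<partial>lborel)"
        using nonneg by (intro nn_integral_cong) (auto simp: indicator_def ennreal_mult [symmetric])
      also have "\<dots> = ennreal (product_density f g t)"
        unfolding product_density_def set_lebesgue_integral_def using int[OF 1] nonneg
        by (intro nn_integral_eq_integral) (auto simp: set_integrable_def indicator_def)
      finally show ?thesis .
    next
      case 2
      have z: "indicator {0<..} x * g (t / x) = 0" for x :: real
        using supp(2)[of "t / x"] 2 by (auto simp: indicator_def divide_neg_pos)
      have "(\<lambda>x. ennreal (f x) * indicator {0<..} x * (ennreal (g (t / x)) * ennreal (1 / x))) = (\<lambda>x. 0)"
        using z by (auto simp: fun_eq_iff indicator_def split: if_splits)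
      moreover have "product_density f g t = 0"
      proof -
        have "(\<lambda>x. indicator {0<..} x *\<^sub>R (f x * g (t / x) * (1 / x))) = (\<lambda>x. 0)"
          using z by (auto simp: fun_eq_iff indicator_def split: if_splits)
        then show ?thesis by (simp add: product_density_def set_lebesgue_integral_def)
      qed
      ultimately show ?thesis by simp
    qed
  qed
  have "distr M lborel (\<lambda>\<omega>. X \<omega> * Y \<omega>) = density lborel (\<lambda>t. ennreal (product_density f g t))"
  proof (rule measure_eqI)
    fix A assume "A \<in> sets (distr M lborel (\<lambda>\<omega>. X \<omega> * Y \<omega>))"
    then have A [measurable]: "A \<in> sets borel" by simp
    have "(\<lambda>p. fst p * snd p) \<in> borel_measurable (lborel \<Otimes>\<^sub>M lborel :: (real \<times> real) measure)"
      by measurable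
    from measurable_sets[OF this A]
    have prod_set: "{p. fst p * snd p \<in> A} \<in> sets (lborel \<Otimes>\<^sub>M lborel :: (real \<times> real) measure)"
      by (simp only: vimage_def space_pair_measure space_lborel space_borel UNIV_Times_UNIV Int_UNIV_right)
    have "emeasure (distr M lborel (\<lambda>\<omega>. X \<omega> * Y \<omega>)) A =
        emeasure (distr M (lborel \<Otimes>\<^sub>M lborel) (\<lambda>\<omega>. (X \<omega>, Y \<omega>))) {p. fst p * snd p \<in> A}"
      using prod_set by (subst (1 2) emeasure_distr) (auto intro!: arg_cong[where f = "emeasure M"])
    also have "\<dots> = (\<integral>\<^sup>+p. (case p of (x, y) \<Rightarrow> ennreal (f x) * ennreal (g y)) * indicator {p. fst p * snd p \<in> A} p \<partial>(lborel \<Otimes>\<^sub>M lborel))"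
      unfolding joint by (rule emeasure_density) (use prod_set in measurable)
    also have "\<dots> = (\<integral>\<^sup>+x. \<integral>\<^sup>+y. ennreal (f x) * ennreal (g y) * indicator A (x * y) \<partial>lborel \<partial>lborel)"
      by (subst lborel.nn_integral_fst [symmetric]) (auto simp: indicator_def intro!: nn_integral_cong)
    also have "\<dots> = (\<integral>\<^sup>+x. \<integral>\<^sup>+t. ennreal (f x) * indicator {0<..} x * (ennreal (g (t / x)) * ennreal (1 / x)) * indicator A t \<partial>lborel \<partial>lborel)"
    proof (rule nn_integral_cong_AE)
      \<comment> \<open>Fibres over negative \<open>x\<close> contribute nothing because
        \<open>f\<close> vanishes there, and \<open>x = 0\<close> is a null set.\<close>
      show "AE x in lborel. (\<integral>\<^sup>+y. ennreal (f x) * ennreal (g y) * indicator A (x * y) \<partial>lborel) =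
          (\<integral>\<^sup>+t. ennreal (f x) * indicator {0<..} x * (ennreal (g (t / x)) * ennreal (1 / x)) * indicator A t \<partial>lborel)"
        using AE_lborel_singleton[of 0]
      proof eventually_elim
        fix x :: real assume "x \<noteq> 0"
        then consider "x > 0" | "x < 0" by linarith
        then show "(\<integral>\<^sup>+y. ennreal (f x) * ennreal (g y) * indicator A (x * y) \<partial>lborel) =
          (\<integral>\<^sup>+t. ennreal (f x) * indicator {0<..} x * (ennreal (g (t / x)) * ennreal (1 / x)) * indicator A t \<partial>lborel)"
        proof cases
          case 1
          have "(\<integral>\<^sup>+y. ennreal (f x) * ennreal (g y) * indicator A (x * y) \<partial>lborel) =
              ennreal \<bar>1 / x\<bar> * (\<integral>\<^sup>+t. ennreal (f x) * ennreal (g (0 + 1 / x * t)) * indicator A (x * (0 + 1 / x * t)) \<partial>lborel)"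
            by (rule nn_integral_real_affine) (use 1 in auto)
          also have "\<dots> = (\<integral>\<^sup>+t. ennreal \<bar>1 / x\<bar> * (ennreal (f x) * ennreal (g (0 + 1 / x * t)) * indicator A (x * (0 + 1 / x * t))) \<partial>lborel)"
            by (rule nn_integral_cmult [symmetric]) measurable
          finally show ?thesis using 1 by (simp add: mult_ac)
        next
          case 2
          then show ?thesis by (simp add: supp(1))
        qed
      qed
    qed
    also have "\<dots> = (\<integral>\<^sup>+t. \<integral>\<^sup>+x. ennreal (f x) * indicator {0<..} x * (ennreal (g (t / x)) * ennreal (1 / x)) * indicator A t \<partial>lborel \<partial>lborel)"
      by (rule lborel_pair.Fubini') measurable
    also have "\<dots> = (\<integral>\<^sup>+t. (\<integral>\<^sup>+x. ennreal (f x) * indicator {0<..} x * (ennreal (g (t / x)) * ennreal (1 / x)) \<partial>lborel) * indicator A t \<partial>lborel)"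
      by (intro nn_integral_cong nn_integral_multc) measurable
    also have "\<dots> = (\<integral>\<^sup>+t. ennreal (product_density f g t) * indicator A t \<partial>lborel)"
      by (rule nn_integral_cong_AE, rule AE_mp[OF dens_eq]) simp
    also have "\<dots> = emeasure (density lborel (\<lambda>t. ennreal (product_density f g t))) A"
      by (rule emeasure_density [symmetric]) auto
    finally show "emeasure (distr M lborel (\<lambda>\<omega>. X \<omega> * Y \<omega>)) A =
        emeasure (density lborel (\<lambda>t. ennreal (product_density f g t))) A" .
  qed simp
  then show ?thesis by (auto simp: distributed_def)
qed

theorem lemma2p2:
  fixes \<Omega> :: "'a measure"
    and X Y :: "'a \<Rightarrow> real"
    and f g :: "real \<Rightarrow> real"
    and \<alpha> \<beta> :: real
    and M N :: nat
    and a b \<xi> \<eta> :: "nat \<Rightarrow> complex"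
  assumes "prob_space \<Omega>"
    and "prob_space.indep_var \<Omega> borel X borel Y"
    and "AE \<omega> in \<Omega>. 0 \<le> X \<omega>"
    and "AE \<omega> in \<Omega>. 0 \<le> Y \<omega>"
    and "distributed \<Omega> lborel X (\<lambda>x. ennreal (f x))"
    and "distributed \<Omega> lborel Y (\<lambda>y. ennreal (g y))"
    and "\<And>x. 0 \<le> f x"
    and "\<And>y. 0 \<le> g y"
    and "\<And>x. x < 0 \<Longrightarrow> f x = 0"
    and "\<And>y. y < 0 \<Longrightarrow> g y = 0"
    and "\<alpha> > 0"
    and "\<beta> > 0"
    and "\<And>m. m \<in> {1..M} \<Longrightarrow> Re (\<xi> m) > 0"
    and "\<And>n. n \<in> {1..N} \<Longrightarrow> Re (\<eta> n) > 0"
    and "\<And>x. x > 0 \<Longrightarrow> complex_of_real (f x) =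
           of_real (x powr (\<alpha> - 1)) * (\<Sum>m=1..M. a m * exp (- \<xi> m * of_real x))"
    and "\<And>y. y > 0 \<Longrightarrow> complex_of_real (g y) =
           of_real (y powr (\<beta> - 1)) * (\<Sum>n=1..N. b n * exp (- \<eta> n * of_real y))"
  shows "distributed \<Omega> lborel (\<lambda>\<omega>. X \<omega> * Y \<omega>) (\<lambda>t. ennreal (product_density f g t)) \<and>
    (\<forall>t>0.
       set_integrable lborel {0<..} (\<lambda>x. f x * g (t / x) * (1 / x)) \<and>
       complex_of_real (product_density f g t) =
         of_real (t powr ((\<alpha> + \<beta> - 2 - \<bar>\<alpha> - \<beta>\<bar>) / 2)) *
         (2 * (\<Sum>m=1..M. \<Sum>n=1..N.
            a m * b n * (\<eta> n / \<xi> m) powr of_real ((\<alpha> - \<beta>) / 2) *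
            of_real (t powr (\<bar>\<alpha> - \<beta>\<bar> / 2)) *
            bessel_K (of_real \<bar>\<alpha> - \<beta>\<bar>) (2 * csqrt (of_real t * \<xi> m * \<eta> n)))))"
proof -
  have int: "set_integrable lborel {0<..} (\<lambda>x. f x * g (t / x) * (1 / x))" if "t > 0" for t
    by (rule product_density_exponential_sums(1)[OF that assms(13-16)])
  have "complex_of_real (product_density f g t) =
         of_real (t powr ((\<alpha> + \<beta> - 2 - \<bar>\<alpha> - \<beta>\<bar>) / 2)) *
         (2 * (\<Sum>m=1..M. \<Sum>n=1..N.
            a m * b n * (\<eta> n / \<xi> m) powr of_real ((\<alpha> - \<beta>) / 2) *
            of_real (t powr (\<bar>\<alpha> - \<beta>\<bar> / 2)) *
            bessel_K (of_real \<bar>\<alpha> - \<beta>\<bar>) (2 * csqrt (of_real t * \<xi> m * \<eta> n))))" if t: "t > 0" for t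
  proof -
    \<comment> \<open>Both exponents add up to \<open>(\<alpha> + \<beta> - 2) / 2\<close>: the
      absolute value cancels in the power of \<open>t\<close> and matters only in the order of
      \<open>bessel_K\<close>, while the quotient of rates keeps the signed exponent.\<close>
    have "t powr (\<beta> - 1) * t powr ((\<alpha> - \<beta>) / 2) =
        t powr ((\<alpha> + \<beta> - 2 - \<bar>\<alpha> - \<beta>\<bar>) / 2) * t powr (\<bar>\<alpha> - \<beta>\<bar> / 2)"
      by (simp add: powr_add [symmetric] field_simps)
    then have pow: "complex_of_real (t powr (\<beta> - 1)) * of_real (t powr ((\<alpha> - \<beta>) / 2)) =
        of_real (t powr ((\<alpha> + \<beta> - 2 - \<bar>\<alpha> - \<beta>\<bar>) / 2)) * of_real (t powr (\<bar>\<alpha> - \<beta>\<bar> / 2))"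
      by (simp only: of_real_mult [symmetric])
    have density: "complex_of_real (product_density f g t) = of_real (t powr (\<beta> - 1)) *
        (\<Sum>m=1..M. \<Sum>n=1..N. a m * b n * bessel_integral (of_real (\<alpha> - \<beta>)) (\<xi> m) (of_real t * \<eta> n))"
      by (rule product_density_exponential_sums(2)[OF t assms(13-16)])
    show ?thesis
      unfolding density sum_distrib_left
    proof (intro sum.cong refl)
      fix m n assume "m \<in> {1..M}" "n \<in> {1..N}"
      then have "Re (\<xi> m) > 0" "Re (\<eta> n) > 0" using assms(13,14) by auto
      from bessel_integral_conv_K[OF this t, of "\<alpha> - \<beta>"] pow
      show "of_real (t powr (\<beta> - 1)) * (a m * b n * bessel_integral (of_real (\<alpha> - \<beta>)) (\<xi> m) (of_real t * \<eta> n)) =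
          of_real (t powr ((\<alpha> + \<beta> - 2 - \<bar>\<alpha> - \<beta>\<bar>) / 2)) *
          (2 * (a m * b n * (\<eta> n / \<xi> m) powr of_real ((\<alpha> - \<beta>) / 2) *
            of_real (t powr (\<bar>\<alpha> - \<beta>\<bar> / 2)) *
            bessel_K (of_real \<bar>\<alpha> - \<beta>\<bar>) (2 * csqrt (of_real t * \<xi> m * \<eta> n))))"
        by algebra
    qed
  qed
  moreover have "distributed \<Omega> lborel (\<lambda>\<omega>. X \<omega> * Y \<omega>) (\<lambda>t. ennreal (product_density f g t))"
    by (rule prob_space.distributed_product[OF assms(1,2,5,6,7,8,9,10) int])
  ultimately show ?thesis using int by blast
qed

end
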